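(* Let $f(\tau)=\sum_{n\ge1}a_ne^{2\pi in\tau}$ be a nonzero holomorphic cusp form of weight $k>0$ on $\Gamma=SL_2(\mathbb Z)$ with multipliers $A(\gamma)$ (in the sense of the context), and put $S(x,\alpha)=\sum_{n\le x}a_ne^{2\pi in\alpha}$. Let $\gamma=\begin{pmatrix}a&b\\c&d\end{pmatrix}\in\Gamma$ with $c>0$. If there exists a positive integer $n$ such that $\Re[A(\gamma)a_ne^{-2\pi ind/c}]\ne0$, then for $\alpha=a/c$, $$\Re[S(x,\alpha)]=\Omega_\pm\left(x^{\frac k2-\frac14}\right)\quad\text{as }x\to+\infty.$$
   Context: Let $\Gamma=SL_2(\mathbb Z)$ and let $\mathbb H$ be the upper half plane. A holomorphic cusp form of weight $k>0$ on $\Gamma$ is a function $f$, holomorphic on $\mathbb H\cup\{\infty\}$ with $f(\infty)=0$, such that for every $\gamma=\begin{pmatrix}a&b\\c&d\end{pmatrix}\in\Gamma$ with $c>0$ there is a complex number $A(\gamma)$ of modulus $1$ with $$f\left(\frac{a\tau+b}{c\tau+d}\right)=A(\gamma)[-i(c\tau+d)]^kf(\tau)\qquad(\tau\in\mathbb H),$$ with the principal branch of the power. It is assumed that $f(\tau)=\sum_{n\ge1}a_ne^{2\pi in\tau}$ (so $f(\tau+1)=f(\tau)$) with not all $a_n$ equal to zero. For real-valued $g$ and positive $h$, $g(x)=\Omega_\pm(h(x))$ means that both $\limsup_{x\to+\infty}g(x)/h(x)>0$ and $\liminf_{x\to+\infty}g(x)/h(x)<0$. *)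

theory Defs
  imports "HOL-Complex_Analysis.Complex_Analysis"
begin

definition SL2Z :: "(int ^ 2 ^ 2) set" where
  "SL2Z = {\<gamma>. det \<gamma> = 1}"

definition upper_half_plane :: "complex set" where
  "upper_half_plane = {\<tau>. Im \<tau> > 0}"

definition moebius :: "int ^ 2 ^ 2 \<Rightarrow> complex \<Rightarrow> complex" where
  "moebius \<gamma> \<tau> =
     (of_int (\<gamma> $ 1 $ 1) * \<tau> + of_int (\<gamma> $ 1 $ 2)) /
     (of_int (\<gamma> $ 2 $ 1) * \<tau> + of_int (\<gamma> $ 2 $ 2))"

text \<open>
  Holomorphy at the cusp, with value \<open>0\<close> there, is expressed in the local coordinate
  \<open>q = exp (2 \<pi> \<i> \<tau>)\<close>; in particular \<open>f\<close> has period 1 on the upper half plane.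
\<close>

definition holomorphic_zero_at_cusp :: "(complex \<Rightarrow> complex) \<Rightarrow> bool" where
  "holomorphic_zero_at_cusp f \<longleftrightarrow>
     (\<exists>g. g holomorphic_on ball 0 1 \<and> g 0 = 0 \<and>
          (\<forall>\<tau>\<in>upper_half_plane. f \<tau> = g (exp (2 * pi * \<i> * \<tau>))))"

text \<open>
  Only the values \<open>A \<gamma>\<close> at matrices of determinant 1 with positive lower left entry are
  constrained; for those matrices \<open>- \<i> * (c * \<tau> + d)\<close> has positive real part, so the
  principal branch taken by \<open>powr\<close> is evaluated away from its cut.  If \<open>f\<close> does not
  vanish identically on the upper half plane, these values are determined by \<open>f\<close> and \<open>k\<close>.
\<close>

definition cusp_form :: "real \<Rightarrow> (int ^ 2 ^ 2 \<Rightarrow> complex) \<Rightarrow> (complex \<Rightarrow> complex) \<Rightarrow> bool" where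
  "cusp_form k A f \<longleftrightarrow>
     f holomorphic_on upper_half_plane \<and>
     holomorphic_zero_at_cusp f \<and>
     (\<forall>\<gamma>\<in>SL2Z. \<gamma> $ 2 $ 1 > 0 \<longrightarrow>
        norm (A \<gamma>) = 1 \<and>
        (\<forall>\<tau>\<in>upper_half_plane.
           f (moebius \<gamma> \<tau>) =
             A \<gamma> * (- \<i> * (of_int (\<gamma> $ 2 $ 1) * \<tau> + of_int (\<gamma> $ 2 $ 2))) powr complex_of_real k
               * f \<tau>))"

definition fourier_expansion :: "(nat \<Rightarrow> complex) \<Rightarrow> (complex \<Rightarrow> complex) \<Rightarrow> bool" where
  "fourier_expansion a f \<longleftrightarrow>
     (\<forall>\<tau>\<in>upper_half_plane.
        ((\<lambda>n. a n * exp (2 * pi * \<i> * of_nat n * \<tau>)) has_sum f \<tau>) {1..})"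

definition twisted_sum :: "(nat \<Rightarrow> complex) \<Rightarrow> real \<Rightarrow> real \<Rightarrow> complex" where
  "twisted_sum a x \<alpha> =
     (\<Sum>n | 1 \<le> n \<and> real n \<le> x. a n * exp (2 * pi * \<i> * of_nat n * of_real \<alpha>))"

text \<open>
  The limits are taken over real \<open>x\<close> and in the extended reals, as the quotient may be unbounded.
\<close>

definition Omega_pm :: "(real \<Rightarrow> real) \<Rightarrow> (real \<Rightarrow> real) \<Rightarrow> bool" where
  "Omega_pm g h \<longleftrightarrow>
     Limsup at_top (\<lambda>x. ereal (g x / h x)) > 0 \<and>
     Liminf at_top (\<lambda>x. ereal (g x / h x)) < 0"

end

theory Submission
  imports Defs "HOL-Probability.Distributions"
begin

text \<open>
  On the vertical line above \<open>a / c\<close> the transformation law of \<open>f\<close> relates, after taking real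
  parts, the real sequences \<open>b n = Re (a n * exp (2 \<pi> i n a / c))\<close> and
  \<open>B n = Re (A \<gamma> * a n * exp (- 2 \<pi> i n d / c))\<close> by
  \<open>\<Sum> b n exp (- n / v) = C v powr k * \<Sum> B n exp (- \<lambda> n v)\<close> with \<open>\<lambda> = (2 \<pi> / c)\<^sup>2\<close>.
  Integrating this against \<open>v powr (-1/2) * exp (- w\<^sup>2 v / 4)\<close> gives
  \<open>\<Sum> b n exp (- w sqrt n) = C' w * \<Sum> B n (w\<^sup>2 / 4 + \<lambda> n) powr (- k - 1/2)\<close>, first for real \<open>w > 0\<close>
  and then for \<open>Re w > 0\<close> by analytic continuation.  The left side is \<open>w\<close> times the Laplace transform
  of \<open>y \<mapsto> S (y\<^sup>2)\<close>; the right side has a singularity at \<open>w = 2 i sqrt (\<lambda> m)\<close> whenever \<open>B m\<close> is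
  nonzero, but stays bounded near \<open>0\<close>.  A one-sided bound \<open>S x \<le> \<epsilon> x powr (k/2 - 1/4)\<close> would, by testing with a
  nonnegative weight of the form \<open>exp (- \<delta> y) * (1 + cos (\<mu> y - \<psi>))\<close>, bound the strength of that
  singularity by a constant times \<open>\<epsilon>\<close>, which is impossible for small \<open>\<epsilon>\<close>.  All series converge absolutely because
  the sum of \<open>|a n|\<^sup>2\<close> over \<open>n \<le> N\<close> is \<open>O (N powr k)\<close>.
\<close>

section \<open>Laplace-type integrals\<close>

text \<open>Nonnegativity makes integrability follow from the two limits of the primitive, so an
  explicit \<open>F\<close> delivers integrability and value at once.\<close>

lemma has_bochner_integral_FTC_Ioi_nonneg:
  fixes f F :: "real \<Rightarrow> real"
  assumes "\<And>x. x > c \<Longrightarrow> (F has_real_derivative f x) (at x)"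
    and "\<And>x. x > c \<Longrightarrow> isCont f x"
    and "\<And>x. x > c \<Longrightarrow> f x \<ge> 0"
    and "(F \<longlongrightarrow> A) (at_right c)" "(F \<longlongrightarrow> B) at_top"
  shows "has_bochner_integral lborel (\<lambda>x. indicator {c<..} x *\<^sub>R f x) (B - A)"
proof -
  have "set_integrable lborel (einterval (ereal c) \<infinity>) f"
       "(LBINT x=ereal c..\<infinity>. f x) = B - A"
    by (rule interval_integral_FTC_nonneg[where F = F];
        use assms in \<open>force simp: ereal_tendsto_simps\<close>)+
  moreover have "einterval (ereal c) \<infinity> = {c<..}" by (auto simp: einterval_def)
  ultimately show ?thesis
    by (auto simp: set_integrable_def interval_lebesgue_integral_def set_lebesgue_integral_def
        has_bochner_integral_iff)
qed

lemma has_bochner_integral_exp_Ici_real: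
  fixes r :: real
  assumes "r > 0"
  shows "has_bochner_integral lborel (\<lambda>y. indicator {c..} y *\<^sub>R exp (- r * y)) (exp (- r * c) / r)"
proof -
  have "((\<lambda>y. exp (- r * y)) \<longlongrightarrow> 0) at_top"
    using assms by real_asymp
  from tendsto_divide[OF tendsto_minus[OF this] tendsto_const[of r]] assms
  have "((\<lambda>y. - exp (- r * y) / r) \<longlongrightarrow> 0) at_top" by simp
  hence "has_bochner_integral lborel (\<lambda>y. indicator {c<..} y *\<^sub>R exp (- r * y)) (0 - - exp (- r * c) / r)"
    by (intro has_bochner_integral_FTC_Ioi_nonneg[where F = "\<lambda>y. - exp (- r * y) / r"])
       (use assms in \<open>auto intro!: derivative_eq_intros tendsto_eq_intros isCont_exp\<close>)
  \<comment> \<open>The open and the closed half-line differ by a null set. The closed one fits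
    partial sums, which include the term at their endpoint.\<close>
  also have "?this \<longleftrightarrow> has_bochner_integral lborel (\<lambda>y. indicator {c..} y *\<^sub>R exp (- r * y)) (0 - - exp (- r * c) / r)"
    by (rule has_bochner_integral_discrete_difference[where X = "{c}"]) (auto simp: indicator_def)
  finally show ?thesis by simp
qed

text \<open>Integrability is inherited from the modulus \<open>exp (- Re w * y)\<close>. The value
  comes from the complex primitive, which vanishes at infinity because its modulus does.\<close>

lemma has_bochner_integral_exp_Ici:
  fixes w :: complex
  assumes "Re w > 0"
  shows "has_bochner_integral lborel (\<lambda>y. indicator {c..} y *\<^sub>R exp (- w * of_real y))
           (exp (- w * of_real c) / w)"
proof -
  have w: "w \<noteq> 0" using assms by auto
  have "integrable lborel (\<lambda>y. indicator {c..} y *\<^sub>R exp (- Re w * y))"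
    using has_bochner_integral_exp_Ici_real[OF assms] by (simp add: has_bochner_integral_iff)
  hence "integrable lborel (\<lambda>y. indicator {c<..} y *\<^sub>R exp (- w * of_real y))"
    by (rule Bochner_Integration.integrable_bound) (auto simp: indicator_def)
  hence int: "set_integrable lborel (einterval (ereal c) \<infinity>) (\<lambda>y. exp (- w * of_real y))"
    and ei: "einterval (ereal c) \<infinity> = {c<..}"
    by (auto simp: einterval_def greaterThan_def set_integrable_def)
  have lim_real: "((\<lambda>y. exp (- Re w * y)) \<longlongrightarrow> 0) at_top"
    using assms by real_asymp
  have "((\<lambda>y. - exp (- w * of_real y) / w) \<longlongrightarrow> 0) at_top"
  proof (rule tendsto_norm_zero_cancel)
    show "((\<lambda>y. norm (- exp (- w * of_real y) / w)) \<longlongrightarrow> 0) at_top"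
      using tendsto_divide[OF lim_real tendsto_const[of "norm w"]] w
      by (simp add: norm_divide)
  qed
  hence "(LBINT x=ereal c..\<infinity>. exp (- w * of_real x)) = 0 - (- exp (- w * of_real c) / w)"
    by (intro interval_integral_FTC_integrable[where F = "\<lambda>y. - exp (- w * of_real y) / w"] int)
       (use w in \<open>auto simp: ereal_tendsto_simps
         intro!: derivative_eq_intros tendsto_eq_intros isCont_exp has_vector_derivative_real_field\<close>)
  with int have "has_bochner_integral lborel (\<lambda>y. indicator {c<..} y *\<^sub>R exp (- w * of_real y))
           (exp (- w * of_real c) / w)"
    by (auto simp: interval_lebesgue_integral_def set_lebesgue_integral_def set_integrable_def
        has_bochner_integral_iff ei)
  also have "?this \<longleftrightarrow> ?thesis"
    by (rule has_bochner_integral_discrete_difference[where X = "{c}"]) (auto simp: indicator_def)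
  finally show ?thesis .
qed

text \<open>This is \<open>sqrt pi / 2\<close> times the error function. The limit at infinity is
  the half-line Gaussian moment, and oddness transfers it to minus infinity.\<close>

lemma gaussian_primitive:
  obtains P :: "real \<Rightarrow> real" where
    "\<And>x. (P has_real_derivative exp (- x\<^sup>2)) (at x)"
    "(P \<longlongrightarrow> sqrt pi / 2) at_top" "(P \<longlongrightarrow> - sqrt pi / 2) at_bot"
proof
  define P :: "real \<Rightarrow> real" where "P x = (LBINT t=0..x. exp (- t\<^sup>2))" for x
  show "(P has_real_derivative exp (- x\<^sup>2)) (at x)" for x
  proof -
    \<comment> \<open>The fundamental theorem is applied on a compact interval; this choice puts
      \<open>x\<close> in the interior of \<open>{-m..m}\<close>, so the derivative within it is a
      full derivative.\<close>
    define m where "m = \<bar>x\<bar> + 1"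
    have "((\<lambda>u. LBINT t=0..u. exp (- t\<^sup>2)) has_vector_derivative exp (- x\<^sup>2)) (at x within {-m..m})"
      using interval_integral_FTC2[of "-m" 0 m "\<lambda>t. exp (- t\<^sup>2)" x]
      by (simp add: m_def zero_ereal_def continuous_intros)
    hence "((\<lambda>u. LBINT t=0..u. exp (- t\<^sup>2)) has_vector_derivative exp (- x\<^sup>2)) (at x)"
      by (subst (asm) at_within_interior) (auto simp: m_def)
    thus ?thesis by (simp add: has_real_derivative_iff_has_vector_derivative P_def[abs_def])
  qed
  have pos: "P x = (\<integral>t. indicator {..x} t *\<^sub>R (indicator {0..} t *\<^sub>R exp (- t\<^sup>2)) \<partial>lborel)"
    if "x \<ge> 0" for x
  proof -
    have "P x = (LBINT t:{0..x}. exp (- t\<^sup>2))"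
      using interval_integral_Icc[of "0" x "\<lambda>t. exp (- t\<^sup>2)"] that
      by (simp add: P_def zero_ereal_def)
    also have "\<dots> = (\<integral>t. indicator {..x} t *\<^sub>R (indicator {0..} t *\<^sub>R exp (- t\<^sup>2)) \<partial>lborel)"
      unfolding set_lebesgue_integral_def
      by (intro Bochner_Integration.integral_cong) (auto simp: indicator_def)
    finally show ?thesis .
  qed
  have "((\<lambda>x. \<integral>t. indicator {..x} t *\<^sub>R (indicator {0..} t *\<^sub>R exp (- t\<^sup>2 :: real)) \<partial>lborel)
          \<longlongrightarrow> (\<integral>t. indicator {0..} t *\<^sub>R exp (- t\<^sup>2 :: real) \<partial>lborel)) at_top"
    using gaussian_moment_0 by (intro tendsto_integral_at_top) (auto simp: has_bochner_integral_iff)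
  also have "(\<integral>t. indicator {0..} t *\<^sub>R exp (- t\<^sup>2 :: real) \<partial>lborel) = sqrt pi / 2"
    using gaussian_moment_0 by (simp add: has_bochner_integral_iff)
  finally show top: "(P \<longlongrightarrow> sqrt pi / 2) at_top"
    by (rule Lim_transform_eventually)
       (use eventually_ge_at_top[of "0::real"] in eventually_elim, use pos in auto)
  have odd: "P (- x) = - P x" for x
  proof -
    have "(LBINT t=0..x. exp (- t\<^sup>2)) = (LBINT t=-ereal x..-0. exp (- (-t)\<^sup>2))"
      by (rule interval_integral_reflect)
    thus ?thesis
      by (simp add: P_def interval_integral_endpoints_reverse[of 0 "ereal (- x)"])
  qed
  have "((\<lambda>x. - P x) \<longlongrightarrow> - (sqrt pi / 2)) at_top"
    by (intro tendsto_minus top)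
  thus "(P \<longlongrightarrow> - sqrt pi / 2) at_bot"
    by (simp add: filterlim_at_bot_mirror odd)
qed

text \<open>The subordination integral, which later turns \<open>exp (- n / v)\<close> into
  \<open>exp (- w * sqrt n)\<close>. It is evaluated through an explicit primitive.\<close>

lemma has_bochner_integral_exp_subordination:
  fixes a b :: real
  assumes "a > 0" "b > 0"
  shows "has_bochner_integral lborel
           (\<lambda>v. indicator {0<..} v *\<^sub>R (v powr (-1/2) * exp (- a\<^sup>2 * v - b\<^sup>2 / v)))
           (sqrt pi / a * exp (- 2 * a * b))"
proof -
  obtain P :: "real \<Rightarrow> real" where P: "\<And>x. (P has_real_derivative exp (- x\<^sup>2)) (at x)"
    and top: "(P \<longlongrightarrow> sqrt pi / 2) at_top" and bot: "(P \<longlongrightarrow> - sqrt pi / 2) at_bot"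
    using gaussian_primitive by blast
  \<comment> \<open>With \<open>s = sqrt v\<close>, the squares of \<open>a*s + b/s\<close> and
    \<open>a*s - b/s\<close> are \<open>a^2*v + b^2/v\<close> plus and minus \<open>2*a*b\<close>.
    The prefactors therefore give both Gaussians the same exponential, and the derivatives of the
    inner arguments add up to \<open>a / s\<close>.\<close>
  define F where "F v = (exp (2*a*b) * P (a * sqrt v + b / sqrt v)
                        + exp (-2*a*b) * P (a * sqrt v - b / sqrt v)) / a" for v
  have "has_bochner_integral lborel
           (\<lambda>v. indicator {0<..} v *\<^sub>R (v powr (-1/2) * exp (- a\<^sup>2 * v - b\<^sup>2 / v)))
           ((exp (2*a*b) * (sqrt pi / 2) + exp (-2*a*b) * (sqrt pi / 2)) / a
            - (exp (2*a*b) * (sqrt pi / 2) + exp (-2*a*b) * (- sqrt pi / 2)) / a)"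
  proof (rule has_bochner_integral_FTC_Ioi_nonneg[where F = F])
    fix v :: real assume v: "v > 0"
    define s where "s = sqrt v"
    have s: "s > 0" "v = s\<^sup>2" "v powr (-1/2) = 1 / s"
      using v powr_half_sqrt[of v] by (auto simp: s_def powr_minus divide_simps)
    have P': "((\<lambda>x. P (g x)) has_real_derivative exp (- (g x)\<^sup>2) * g') (at x)"
      if "(g has_real_derivative g') (at x)" for g g' x
      using DERIV_chain2[OF P that] .
    have sq: "(sqrt has_real_derivative 1 / (2 * s)) (at v)"
      using DERIV_real_sqrt[OF v] by (simp add: s_def field_simps)
    have "(F has_real_derivative
        (exp (2*a*b) * (exp (- (a * sqrt v + b / sqrt v)\<^sup>2) * (a / (2 * s) - b / (2 * s^3)))
        + exp (-2*a*b) * (exp (- (a * sqrt v - b / sqrt v)\<^sup>2) * (a / (2 * s) + b / (2 * s^3)))) / a) (at v)"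
      unfolding F_def
      by (rule derivative_eq_intros P' sq refl | use assms s v in \<open>simp add: s_def[symmetric] field_simps power3_eq_cube\<close>)+
    moreover have "exp (2*a*b) * exp (- (a * sqrt v + b / sqrt v)\<^sup>2) = exp (- a\<^sup>2 * v - b\<^sup>2 / v)"
      "exp (-2*a*b) * exp (- (a * sqrt v - b / sqrt v)\<^sup>2) = exp (- a\<^sup>2 * v - b\<^sup>2 / v)"
      using s(1) unfolding s_def[symmetric] s(2) exp_add[symmetric]
      by (intro arg_cong[where f = exp]; simp add: power2_eq_square field_simps)+
    ultimately show "(F has_real_derivative v powr (-1/2) * exp (- a\<^sup>2 * v - b\<^sup>2 / v)) (at v)"
      using s(1) assms unfolding s(3) mult.assoc[symmetric]
      by (simp add: field_simps)
    show "isCont (\<lambda>v. v powr (-1/2) * exp (- a\<^sup>2 * v - b\<^sup>2 / v)) v"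
      using v by (intro continuous_intros) auto
  next
    \<comment> \<open>At \<open>0\<close> the two inner arguments tend to opposite infinities, at
      infinity to the same one. In the difference of the limits of \<open>F\<close> only the part
      with \<open>exp (-2*a*b)\<close> survives.\<close>
    have l1: "((\<lambda>v. P (a * sqrt v + b / sqrt v)) \<longlongrightarrow> sqrt pi / 2) (at_right 0)"
      by (rule filterlim_compose[OF top]) (use assms in real_asymp)
    have l2: "((\<lambda>v. P (a * sqrt v - b / sqrt v)) \<longlongrightarrow> - sqrt pi / 2) (at_right 0)"
      by (rule filterlim_compose[OF bot]) (use assms in real_asymp)
    have l3: "((\<lambda>v. P (a * sqrt v + b / sqrt v)) \<longlongrightarrow> sqrt pi / 2) at_top"
      by (rule filterlim_compose[OF top]) (use assms in real_asymp)
    have l4: "((\<lambda>v. P (a * sqrt v - b / sqrt v)) \<longlongrightarrow> sqrt pi / 2) at_top"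
      by (rule filterlim_compose[OF top]) (use assms in real_asymp)
    show "(F \<longlongrightarrow> (exp (2*a*b) * (sqrt pi / 2) + exp (-2*a*b) * (- sqrt pi / 2)) / a) (at_right 0)"
      unfolding F_def by (intro tendsto_intros l1 l2) (use assms in auto)
    show "(F \<longlongrightarrow> (exp (2*a*b) * (sqrt pi / 2) + exp (-2*a*b) * (sqrt pi / 2)) / a) at_top"
      unfolding F_def by (intro tendsto_intros l3 l4) (use assms in auto)
  qed auto
  thus ?thesis by (simp add: add_divide_distrib diff_divide_distrib mult_ac)
qed

text \<open>Euler's integral for \<open>Gamma p\<close> after the substitution of
  \<open>x * v\<close> for \<open>v\<close>; the factor \<open>x powr (1 - p)\<close> then removes
  the power of \<open>x\<close> from the integrand.\<close>

lemma has_bochner_integral_powr_exp: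
  fixes p x :: real
  assumes "p > 0" "x > 0"
  shows "has_bochner_integral lborel (\<lambda>v. indicator {0<..} v *\<^sub>R (v powr (p - 1) * exp (- x * v)))
           (Gamma p * x powr (- p))"
proof -
  have "has_bochner_integral lborel (\<lambda>v. indicator {0<..} v *\<^sub>R (v powr (p - 1) * exp (- v))) (Gamma p)"
  proof (rule has_bochner_integral_nn_integral)
    have "(\<integral>\<^sup>+ v. ennreal (indicator {0<..} v *\<^sub>R (v powr (p - 1) * exp (- v))) \<partial>lborel)
      = (\<integral>\<^sup>+ v. ennreal (indicator {0..} v * v powr (p - 1) / exp v) \<partial>lborel)"
      by (rule nn_integral_cong) (auto simp: indicator_def exp_minus field_simps)
    thus "(\<integral>\<^sup>+ v. ennreal (indicator {0<..} v *\<^sub>R (v powr (p - 1) * exp (- v))) \<partial>lborel)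
      = ennreal (Gamma p)"
      using Gamma_conv_nn_integral_real[OF assms(1)] by simp
  qed (use assms in \<open>auto intro: Gamma_real_pos less_imp_le\<close>)
  from lborel_has_bochner_integral_real_affine_iff[of x _ _ 0, THEN iffD1, OF _ this]
  have "has_bochner_integral lborel
      (\<lambda>v. indicator {0<..} (x * v) *\<^sub>R ((x * v) powr (p - 1) * exp (- (x * v)))) (Gamma p / x)"
    using assms by (simp add: divide_inverse mult.commute)
  hence "has_bochner_integral lborel
      (\<lambda>v. x powr (1 - p) * (indicator {0<..} (x * v) *\<^sub>R ((x * v) powr (p - 1) * exp (- (x * v)))))
      (x powr (1 - p) * (Gamma p / x))"
    by (intro has_bochner_integral_mult_right) auto
  moreover have "x powr (1 - p) * (Gamma p / x) = Gamma p * x powr (- p)"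
    using assms by (simp add: powr_diff powr_minus field_simps)
  moreover have "x powr (1 - p) * (indicator {0<..} (x * v) *\<^sub>R ((x * v) powr (p - 1) * exp (- (x * v))))
     = indicator {0<..} v *\<^sub>R (v powr (p - 1) * exp (- x * v))" for v
    using assms by (auto simp: indicator_def powr_mult zero_less_mult_iff powr_add[symmetric] simp flip: mult.assoc)
  ultimately show ?thesis by (simp only:)
qed

section \<open>Sequences related by a theta transformation\<close>

lemma suminf_integral_real:
  fixes c I :: "nat \<Rightarrow> real" and g :: "nat \<Rightarrow> 'a \<Rightarrow> real"
  assumes "\<And>n. c n \<noteq> 0 \<Longrightarrow> has_bochner_integral M (g n) (I n)"
    and "\<And>n x. g n x \<ge> 0"
    and "\<And>x. summable (\<lambda>n. \<bar>c n\<bar> * g n x)"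
    and "summable (\<lambda>n. \<bar>c n\<bar> * I n)"
  shows "(\<Sum>n. c n * I n) = (\<integral>x. (\<Sum>n. c n * g n x) \<partial>M)"
proof -
  have hb: "has_bochner_integral M (\<lambda>x. c n * g n x) (c n * I n)" for n
    by (cases "c n = 0") (auto intro: has_bochner_integral_mult_right has_bochner_integral_zero assms(1))
  have norm_eq: "(\<integral>x. norm (c n * g n x) \<partial>M) = \<bar>c n\<bar> * I n" for n
  proof (cases "c n = 0")
    case False
    have "has_bochner_integral M (\<lambda>x. \<bar>c n\<bar> * g n x) (\<bar>c n\<bar> * I n)"
      by (intro has_bochner_integral_mult_right assms False)
    thus ?thesis using assms(2) by (simp add: has_bochner_integral_iff abs_mult)
  qed auto
  have "(\<integral>x. (\<Sum>n. c n * g n x) \<partial>M) = (\<Sum>n. \<integral>x. c n * g n x \<partial>M)"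
  proof (rule integral_suminf)
    show "integrable M (\<lambda>x. c n * g n x)" for n
      using hb by (simp add: has_bochner_integral_iff)
    show "AE x in M. summable (\<lambda>n. norm (c n * g n x))"
      using assms(2,3) by (simp add: abs_mult)
    show "summable (\<lambda>n. \<integral>x. norm (c n * g n x) \<partial>M)"
      unfolding norm_eq by (rule assms(4))
  qed
  also have "\<dots> = (\<Sum>n. c n * I n)"
    using hb by (simp only: has_bochner_integral_iff)
  finally show ?thesis ..
qed

text \<open>The Weierstrass test on small discs. The majorant need only hold eventually in
  \<open>n\<close>, since a term of the dual series is controlled only once \<open>lam * n\<close>
  dominates the square of \<open>w\<close>.\<close>

lemma holomorphic_suminf:
  fixes f :: "nat \<Rightarrow> complex \<Rightarrow> complex"
  assumes "open S" "\<And>n. f n holomorphic_on S"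
    and "\<And>z. z \<in> S \<Longrightarrow> \<exists>d>0. cball z d \<subseteq> S \<and>
           (\<exists>M. summable M \<and> (\<forall>\<^sub>F n in sequentially. \<forall>w\<in>cball z d. norm (f n w) \<le> M n))"
  shows "(\<lambda>w. \<Sum>n. f n w) holomorphic_on S"
proof (rule holomorphic_uniform_sequence[where f = "\<lambda>N w. \<Sum>n<N. f n w"])
  fix z assume "z \<in> S"
  from assms(3)[OF this] obtain d M where "d > 0" "cball z d \<subseteq> S" "summable M"
    "\<forall>\<^sub>F n in sequentially. \<forall>w\<in>cball z d. norm (f n w) \<le> M n" by blast
  thus "\<exists>d>0. cball z d \<subseteq> S \<and> uniform_limit (cball z d) (\<lambda>N w. \<Sum>n<N. f n w) (\<lambda>w. \<Sum>n. f n w) sequentially"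
    by (intro exI[of _ d] conjI Weierstrass_m_test_ev) auto
qed (use assms in \<open>auto intro!: holomorphic_intros\<close>)

lemma Re_of_real_mult: "Re (of_real x * w) = x * Re w"
  by simp

section \<open>Exponential sums in the square root of the index\<close>

text \<open>The functional equation is separated from modular forms so that it can serve for
  \<open>b\<close>, \<open>B\<close> and again for their negatives. The exponent \<open>p\<close> is
  the order of the singularities of the dual series, and \<open>x powr (k / 2 - 1 / 4)\<close>
  becomes \<open>y powr (p - 1)\<close> for \<open>x = y^2\<close>.\<close>

locale theta_transformation =
  fixes b B :: "nat \<Rightarrow> real" and k lam C p :: real
  assumes k_pos: "k > 0" and lam_pos: "lam > 0" and C_pos: "C > 0" and p_eq: "p = k + 1/2"
    and b0: "b 0 = 0" and B0: "B 0 = 0"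
    and summable_b: "summable (\<lambda>n. \<bar>b n\<bar> * real n powr - p)"
    and summable_B: "summable (\<lambda>n. \<bar>B n\<bar> * real n powr - p)"
    and transformation: "\<And>v. v > 0 \<Longrightarrow>
          (\<Sum>n. b n * exp (- real n / v)) = C * v powr k * (\<Sum>n. B n * exp (- lam * real n * v))"
begin

lemma p_pos: "p > 0" using p_eq k_pos by simp

lemma summable_exp_sqrt:
  assumes "d > 0" "summable (\<lambda>n. \<bar>c n\<bar> * real n powr - p)"
  shows "summable (\<lambda>n. \<bar>c n :: real\<bar> * exp (- d * sqrt (real n)))"
proof (rule summable_comparison_test_ev[OF _ assms(2)])
  have "\<forall>\<^sub>F n in sequentially. exp (- d * sqrt (real n)) \<le> real n powr - p"
    using assms(1) p_pos by real_asymp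
  thus "\<forall>\<^sub>F n in sequentially. norm (\<bar>c n\<bar> * exp (- d * sqrt (real n))) \<le> \<bar>c n\<bar> * real n powr - p"
    by eventually_elim (auto simp: abs_mult intro: mult_left_mono)
qed

lemma summable_exp_linear:
  assumes "d > 0" "summable (\<lambda>n. \<bar>c n\<bar> * real n powr - p)"
  shows "summable (\<lambda>n. \<bar>c n :: real\<bar> * exp (- d * real n))"
proof (rule summable_comparison_test_ev[OF _ assms(2)])
  have "\<forall>\<^sub>F n in sequentially. exp (- d * real n) \<le> real n powr - p"
    using assms(1) p_pos by real_asymp
  thus "\<forall>\<^sub>F n in sequentially. norm (\<bar>c n\<bar> * exp (- d * real n)) \<le> \<bar>c n\<bar> * real n powr - p"
    by eventually_elim (auto simp: abs_mult intro: mult_left_mono)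
qed

lemma summable_shifted_powr:
  assumes "a \<ge> 0" "c 0 = 0" "summable (\<lambda>n. \<bar>c n\<bar> * real n powr - p)"
  shows "summable (\<lambda>n. \<bar>c n :: real\<bar> * (a + lam * real n) powr - p)"
proof (rule summable_comparison_test)
  show "summable (\<lambda>n. lam powr - p * (\<bar>c n\<bar> * real n powr - p))"
    by (intro summable_mult assms)
  show "\<exists>N. \<forall>n\<ge>N. norm (\<bar>c n\<bar> * (a + lam * real n) powr - p) \<le> lam powr - p * (\<bar>c n\<bar> * real n powr - p)"
  proof (intro exI[of _ 1] allI impI)
    fix n :: nat assume n: "n \<ge> 1"
    have "(a + lam * real n) powr - p \<le> (lam * real n) powr - p"
      using assms lam_pos p_pos n by (intro powr_mono2') auto
    also have "\<dots> = lam powr - p * real n powr - p"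
      using lam_pos by (simp add: powr_mult)
    finally have "\<bar>c n\<bar> * (a + lam * real n) powr - p \<le> \<bar>c n\<bar> * (lam powr - p * real n powr - p)"
      by (intro mult_left_mono) auto
    thus "norm (\<bar>c n\<bar> * (a + lam * real n) powr - p) \<le> lam powr - p * (\<bar>c n\<bar> * real n powr - p)"
      by (simp add: abs_mult mult_ac)
  qed
qed

text \<open>What remains of the Gamma integral, \<open>C * Gamma p\<close>, after division by the
  constant \<open>sqrt pi / (w/2)\<close> of the subordination integral; the factor \<open>w\<close>
  is kept apart.\<close>

definition dual_const :: real where "dual_const = C * Gamma p / (2 * sqrt pi)"

lemma dual_const_pos: "dual_const > 0"
  unfolding dual_const_def using C_pos p_pos by (auto intro!: divide_pos_pos mult_pos_pos Gamma_real_pos)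

text \<open>The weighted left side integrates by subordination with \<open>a = w/2\<close> and
  \<open>b = sqrt n\<close>. On the right, \<open>v powr (-1/2) * v powr k\<close> is
  \<open>v powr (p - 1)\<close>, and each term is a Gamma integral.\<close>

lemma sqrt_exponential_sum_real:
  assumes "w > 0"
  shows "(\<Sum>n. b n * exp (- w * sqrt (real n))) =
         dual_const * w * (\<Sum>n. B n * (w\<^sup>2 / 4 + lam * real n) powr - p)"
proof -
  define g where "g n v = indicator {0<..} v *\<^sub>R
     (v powr (-1/2) * exp (- (w/2)\<^sup>2 * v - (sqrt (real n))\<^sup>2 / v))" for n v
  define h where "h n v = indicator {0<..} v *\<^sub>R
     (v powr (p - 1) * exp (- (w\<^sup>2 / 4 + lam * real n) * v))" for n v
  have g_eq: "g n v = indicator {0<..} v * v powr (-1/2) * exp (- (w/2)\<^sup>2 * v) * exp (- (1 / v) * real n)" for n v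
    by (simp add: g_def mult.assoc flip: exp_add)
  have h_eq: "h n v = indicator {0<..} v * v powr (p - 1) * exp (- (w\<^sup>2/4) * v) * exp (- (lam * v) * real n)" for n v
    by (simp add: h_def mult.assoc algebra_simps flip: exp_add)
  \<comment> \<open>The theta transformation enters here, as an equality of integrands; for
    \<open>v \<le> 0\<close> both vanish by the indicators.\<close>
  have integrand: "(\<Sum>n. b n * g n v) = (\<Sum>n. (C * B n) * h n v)" for v
  proof (cases "v > 0")
    case True
    have sb: "summable (\<lambda>n. b n * exp (- real n / v))"
      using summable_exp_linear[OF _ summable_b, of "1 / v"] True
      by (intro summable_norm_cancel[of "\<lambda>n. b n * exp (- real n / v)"]) (simp add: abs_mult)
    have sB: "summable (\<lambda>n. B n * exp (- lam * real n * v))"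
      using summable_exp_linear[OF _ summable_B, of "lam * v"] True lam_pos
      by (intro summable_norm_cancel[of "\<lambda>n. B n * exp (- lam * real n * v)"]) (simp add: abs_mult mult_ac)
    have "(\<Sum>n. b n * g n v) = (\<Sum>n. (v powr (-1/2) * exp (- (w/2)\<^sup>2 * v)) * (b n * exp (- real n / v)))"
      using True by (simp add: g_eq mult_ac)
    also have "\<dots> = (v powr (-1/2) * exp (- (w/2)\<^sup>2 * v)) * (\<Sum>n. b n * exp (- real n / v))"
      by (rule suminf_mult[OF sb])
    also have "\<dots> = (C * v powr (p - 1) * exp (- (w/2)\<^sup>2 * v)) * (\<Sum>n. B n * exp (- lam * real n * v))"
    proof -
      have powr_eq: "v powr (p - 1) = v powr (-1/2) * v powr k"
        by (simp add: p_eq flip: powr_add)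
      show ?thesis unfolding transformation[OF True] powr_eq by (simp only: mult_ac)
    qed
    also have "\<dots> = (\<Sum>n. (C * v powr (p - 1) * exp (- (w/2)\<^sup>2 * v)) * (B n * exp (- lam * real n * v)))"
      by (rule suminf_mult[OF sB, symmetric])
    also have "\<dots> = (\<Sum>n. (C * B n) * h n v)"
      using True by (simp add: h_eq mult_ac power_divide)
    finally show ?thesis .
  qed (simp add: g_def h_def)
  have "(\<Sum>n. b n * (sqrt pi / (w/2) * exp (- 2 * (w/2) * sqrt (real n)))) = (\<integral>v. (\<Sum>n. b n * g n v) \<partial>lborel)"
  proof (rule suminf_integral_real)
    show "has_bochner_integral lborel (g n) (sqrt pi / (w/2) * exp (- 2 * (w/2) * sqrt (real n)))"
      if "b n \<noteq> 0" for n
    proof -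
      \<comment> \<open>Subordination requires \<open>sqrt n\<close> to be positive, and the
        vanishing of \<open>b 0\<close> removes the one exception.\<close>
      have "n > 0" using that b0 by (cases n) auto
      thus ?thesis unfolding g_def
        using assms by (intro has_bochner_integral_exp_subordination) auto
    qed
    show "g n v \<ge> 0" for n v by (simp add: g_def)
    show "summable (\<lambda>n. \<bar>b n\<bar> * g n v)" for v
    proof (cases "v > 0")
      case True
      have "summable (\<lambda>n. (v powr (-1/2) * exp (- (w/2)\<^sup>2 * v)) * (\<bar>b n\<bar> * exp (- (1 / v) * real n)))"
        by (intro summable_mult summable_exp_linear summable_b) (use True in auto)
      thus ?thesis using True by (simp add: g_eq mult_ac)
    qed (simp add: g_def)
    have "summable (\<lambda>n. sqrt pi / (w/2) * (\<bar>b n\<bar> * exp (- w * sqrt (real n))))"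
      by (intro summable_mult summable_exp_sqrt assms summable_b)
    thus "summable (\<lambda>n. \<bar>b n\<bar> * (sqrt pi / (w/2) * exp (- 2 * (w/2) * sqrt (real n))))"
      by (simp add: mult_ac)
  qed
  also have "\<dots> = (\<integral>v. (\<Sum>n. (C * B n) * h n v) \<partial>lborel)"
    by (simp only: integrand)
  also have "\<dots> = (\<Sum>n. (C * B n) * (Gamma p * (w\<^sup>2 / 4 + lam * real n) powr - p))"
  proof (rule suminf_integral_real[symmetric])
    show "has_bochner_integral lborel (h n) (Gamma p * (w\<^sup>2 / 4 + lam * real n) powr - p)" for n
      unfolding h_def using assms lam_pos p_pos by (intro has_bochner_integral_powr_exp) (auto intro!: add_pos_nonneg)
    show "h n v \<ge> 0" for n v by (simp add: h_def)
    show "summable (\<lambda>n. \<bar>C * B n\<bar> * h n v)" for v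
    proof (cases "v > 0")
      case True
      have "summable (\<lambda>n. (C * v powr (p - 1) * exp (- (w\<^sup>2/4) * v)) * (\<bar>B n\<bar> * exp (- (lam * v) * real n)))"
        by (intro summable_mult summable_exp_linear summable_B) (use True lam_pos in auto)
      thus ?thesis using True C_pos by (simp add: h_eq mult_ac abs_mult)
    qed (simp add: h_def)
    have "summable (\<lambda>n. (C * Gamma p) * (\<bar>B n\<bar> * (w\<^sup>2 / 4 + lam * real n) powr - p))"
      by (intro summable_mult summable_shifted_powr summable_B B0) auto
    thus "summable (\<lambda>n. \<bar>C * B n\<bar> * (Gamma p * (w\<^sup>2 / 4 + lam * real n) powr - p))"
      using C_pos by (simp add: mult_ac abs_mult)
  qed
  finally have eq: "(\<Sum>n. b n * (sqrt pi / (w/2) * exp (- 2 * (w/2) * sqrt (real n)))) =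
    (\<Sum>n. (C * B n) * (Gamma p * (w\<^sup>2 / 4 + lam * real n) powr - p))" .
  have sb: "summable (\<lambda>n. b n * exp (- w * sqrt (real n)))"
    using summable_exp_sqrt[OF assms summable_b]
    by (intro summable_norm_cancel[of "\<lambda>n. b n * exp (- w * sqrt (real n))"]) (simp add: abs_mult)
  have sB: "summable (\<lambda>n. B n * (w\<^sup>2 / 4 + lam * real n) powr - p)"
    using summable_shifted_powr[where a = "w\<^sup>2/4", OF _ B0 summable_B]
    by (intro summable_norm_cancel[of "\<lambda>n. B n * (w\<^sup>2 / 4 + lam * real n) powr - p"]) (simp add: abs_mult)
  from eq suminf_mult[OF sb, of "sqrt pi / (w/2)"] suminf_mult[OF sB, of "C * Gamma p"]
  have "sqrt pi / (w/2) * (\<Sum>n. b n * exp (- w * sqrt (real n))) =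
     C * Gamma p * (\<Sum>n. B n * (w\<^sup>2 / 4 + lam * real n) powr - p)"
    by (simp add: mult_ac)
  thus ?thesis using assms by (simp add: dual_const_def field_simps)
qed

section \<open>Analytic continuation to the right half plane\<close>

text \<open>For \<open>Re w > 0\<close> all bases avoid the cut of the principal power. As
  \<open>w\<close> tends to \<open>2 * \<i> * sqrt (lam * m)\<close> on the boundary, the base of
  index \<open>m\<close> tends to \<open>0\<close>.\<close>

definition dual_series :: "complex \<Rightarrow> complex" where
  "dual_series w = (\<Sum>n. of_real (B n) * (w\<^sup>2 / 4 + of_real (lam * real n)) powr of_real (- p))"

lemma shifted_square_not_nonpos:
  assumes "Re w > 0"
  shows "w\<^sup>2 / 4 + of_real (lam * real n) \<notin> \<real>\<^sub>\<le>\<^sub>0"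
proof
  assume "w\<^sup>2 / 4 + of_real (lam * real n) \<in> \<real>\<^sub>\<le>\<^sub>0"
  hence "Re w * Im w = 0" and le: "((Re w)\<^sup>2 - (Im w)\<^sup>2) / 4 + lam * real n \<le> 0"
    by (auto simp: complex_nonpos_Reals_iff Re_power2 Im_power2)
  hence "Im w = 0" using assms by simp
  with le have "(Re w)\<^sup>2 / 4 + lam * real n \<le> 0" by simp
  moreover have "(Re w)\<^sup>2 / 4 + lam * real n > 0"
    using assms lam_pos by (intro add_pos_nonneg) auto
  ultimately show False by simp
qed

text \<open>Both sides are holomorphic on the right half plane and agree on the positive reals, so
  the identity theorem applies.\<close>

lemma sqrt_exponential_sum_complex:
  assumes "Re w > 0"
  shows "(\<Sum>n. of_real (b n) * exp (- w * of_real (sqrt (real n)))) = of_real dual_const * w * dual_series w"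
proof -
  define S where "S = {w. Re w > 0}"
  define f where "f w = (\<Sum>n. of_real (b n) * exp (- w * of_real (sqrt (real n)))) - of_real dual_const * w * dual_series w" for w
  have S: "open S" "convex S"
    by (simp_all add: S_def open_halfspace_Re_gt convex_halfspace_Re_gt)
  \<comment> \<open>On this disc \<open>Re w\<close> stays at least \<open>Re z / 2\<close>, which
    becomes the uniform decay rate of the exponentials.\<close>
  have ball: "cball z (Re z / 2) \<subseteq> S \<and> (\<forall>w\<in>cball z (Re z / 2). Re w \<ge> Re z / 2)" if "z \<in> S" for z
  proof -
    have "Re w \<ge> Re z / 2" if "w \<in> cball z (Re z / 2)" for w
      using abs_Re_le_cmod[of "z - w"] that by (simp add: dist_norm)
    with that show ?thesis by (force simp: S_def)
  qed
  have hol1: "(\<lambda>w. \<Sum>n. of_real (b n) * exp (- w * of_real (sqrt (real n)))) holomorphic_on S"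
  proof (rule holomorphic_suminf[OF S(1)])
    fix z assume z: "z \<in> S"
    have "\<forall>\<^sub>F n in sequentially. \<forall>w\<in>cball z (Re z / 2).
        norm (of_real (b n) * exp (- w * of_real (sqrt (real n)))) \<le> \<bar>b n\<bar> * exp (- (Re z / 2) * sqrt (real n))"
    proof (intro always_eventually allI ballI)
      fix n :: nat and w assume "w \<in> cball z (Re z / 2)"
      hence "Re z / 2 * sqrt (real n) \<le> Re w * sqrt (real n)"
        using ball[OF z] by (intro mult_right_mono) auto
      thus "norm (of_real (b n) * exp (- w * of_real (sqrt (real n)))) \<le> \<bar>b n\<bar> * exp (- (Re z / 2) * sqrt (real n))"
        by (auto simp: norm_mult intro!: mult_left_mono)
    qed
    moreover have "summable (\<lambda>n. \<bar>b n\<bar> * exp (- (Re z / 2) * sqrt (real n)))"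
      using z by (intro summable_exp_sqrt summable_b) (auto simp: S_def)
    ultimately show "\<exists>d>0. cball z d \<subseteq> S \<and> (\<exists>M. summable M \<and> (\<forall>\<^sub>F n in sequentially. \<forall>w\<in>cball z d.
        norm (of_real (b n) * exp (- w * of_real (sqrt (real n)))) \<le> M n))"
      using ball[OF z] z by (intro exI[of _ "Re z / 2"] conjI exI) (auto simp: S_def)
  qed (auto intro!: holomorphic_intros)
  have hol2: "dual_series holomorphic_on S"
    unfolding dual_series_def
  proof (rule holomorphic_suminf[OF S(1)])
    fix z assume z: "z \<in> S"
    \<comment> \<open>\<open>r\<close> bounds \<open>norm w\<close> on the disc. Once
      \<open>r^2 / 4 \<le> lam / 2 * n\<close>, the base has modulus at least
      \<open>lam / 2 * n\<close>, and \<open>summable_B\<close> supplies the majorant.\<close>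
    define r where "r = norm z + Re z / 2"
    have "\<forall>\<^sub>F n in sequentially. r\<^sup>2 / 4 \<le> lam / 2 * real n \<and> n > 0"
    proof (rule eventually_conj)
      have "filterlim (\<lambda>n. lam / 2 * real n) at_top sequentially"
        using lam_pos by real_asymp
      thus "\<forall>\<^sub>F n in sequentially. r\<^sup>2 / 4 \<le> lam / 2 * real n"
        unfolding filterlim_at_top by blast
    qed (rule eventually_gt_at_top)
    hence "\<forall>\<^sub>F n in sequentially. \<forall>w\<in>cball z (Re z / 2).
        norm (of_real (B n) * (w\<^sup>2 / 4 + of_real (lam * real n)) powr of_real (- p))
         \<le> (lam / 2) powr - p * (\<bar>B n\<bar> * real n powr - p)"
    proof eventually_elim
      case (elim n)
      show ?case
      proof
        fix w assume w: "w \<in> cball z (Re z / 2)"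
        have "norm w \<le> r"
          using norm_triangle_ineq2[of w z] w by (simp add: r_def dist_norm norm_minus_commute)
        hence "norm (w\<^sup>2 / 4) \<le> lam / 2 * real n"
          using elim power_mono[of "norm w" r 2] by (simp add: norm_power norm_divide)
        moreover have "norm (of_real (lam * real n) :: complex) = lam * real n"
          using lam_pos by (simp only: norm_of_real) simp
        ultimately have "norm (w\<^sup>2 / 4 + of_real (lam * real n)) \<ge> lam / 2 * real n"
          using norm_diff_ineq[of "of_real (lam * real n)" "w\<^sup>2/4"] by (simp add: add.commute)
        hence "norm (w\<^sup>2 / 4 + of_real (lam * real n)) powr - p \<le> (lam / 2 * real n) powr - p"
          using elim lam_pos p_pos by (intro powr_mono2') auto
        also have "\<dots> = (lam / 2) powr - p * real n powr - p"
          by (rule powr_mult)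
        finally have "\<bar>B n\<bar> * norm (w\<^sup>2 / 4 + of_real (lam * real n)) powr - p
            \<le> \<bar>B n\<bar> * ((lam / 2) powr - p * real n powr - p)"
          by (intro mult_left_mono) auto
        thus "norm (of_real (B n) * (w\<^sup>2 / 4 + of_real (lam * real n)) powr of_real (- p))
         \<le> (lam / 2) powr - p * (\<bar>B n\<bar> * real n powr - p)"
          by (subst norm_mult, subst norm_powr_real_powr') (simp_all add: mult_ac)
      qed
    qed
    moreover have "summable (\<lambda>n. (lam / 2) powr - p * (\<bar>B n\<bar> * real n powr - p))"
      by (intro summable_mult summable_B)
    ultimately show "\<exists>d>0. cball z d \<subseteq> S \<and> (\<exists>M. summable M \<and> (\<forall>\<^sub>F n in sequentially. \<forall>w\<in>cball z d.
        norm (of_real (B n) * (w\<^sup>2 / 4 + of_real (lam * real n)) powr of_real (- p)) \<le> M n))"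
      using ball[OF z] z by (intro exI[of _ "Re z / 2"] conjI exI) (auto simp: S_def)
  qed (use shifted_square_not_nonpos in \<open>auto intro!: holomorphic_intros simp: S_def\<close>)
  have "f w = 0"
  proof (rule analytic_continuation[where S = S and U = "of_real ` {0<..}" and \<xi> = 1 and f = f])
    show "f holomorphic_on S"
      unfolding f_def using hol1 hol2 by (intro holomorphic_intros)
    show "connected S" using S by (simp add: convex_connected)
    show "(of_real :: real \<Rightarrow> complex) ` {0<..} \<subseteq> S" "1 \<in> S" "w \<in> S"
      using assms by (auto simp: S_def)
    show "(1 :: complex) islimpt of_real ` {0<..}"
      unfolding islimpt_approachable
    proof (intro allI impI)
      fix e :: real assume "e > 0"
      thus "\<exists>x'\<in>complex_of_real ` {0<..}. x' \<noteq> 1 \<and> dist x' 1 < e"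
        by (intro bexI[of _ "of_real (1 + e / 2)"] imageI) (auto simp: dist_norm)
    qed
  next
    fix z assume "z \<in> complex_of_real ` {0<..}"
    then obtain x where x: "z = of_real x" "x > 0" by auto
    have "dual_series z = of_real (\<Sum>n. B n * (x\<^sup>2 / 4 + lam * real n) powr - p)"
    proof -
      have term_eq: "of_real (B n * (x\<^sup>2 / 4 + lam * real n) powr - p) =
         of_real (B n) * (z\<^sup>2 / 4 + of_real (lam * real n)) powr of_real (- p)" for n
      proof -
        have "x\<^sup>2 / 4 + lam * real n \<ge> 0" using lam_pos by simp
        hence "of_real ((x\<^sup>2 / 4 + lam * real n) powr - p) =
               (of_real (x\<^sup>2 / 4 + lam * real n) :: complex) powr of_real (- p)"
          by (rule powr_of_real[symmetric])
        thus ?thesis by (simp add: x)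
      qed
      have "summable (\<lambda>n. B n * (x\<^sup>2 / 4 + lam * real n) powr - p)"
        using summable_shifted_powr[where a = "x\<^sup>2/4", OF _ B0 summable_B]
        by (intro summable_norm_cancel[of "\<lambda>n. B n * (x\<^sup>2 / 4 + lam * real n) powr - p"]) (simp add: abs_mult)
      hence "of_real (\<Sum>n. B n * (x\<^sup>2 / 4 + lam * real n) powr - p) =
         (\<Sum>n. of_real (B n * (x\<^sup>2 / 4 + lam * real n) powr - p) :: complex)"
        by (rule suminf_of_real)
      thus ?thesis unfolding dual_series_def by (simp only: term_eq)
    qed
    moreover have "(\<Sum>n. of_real (b n) * exp (- z * of_real (sqrt (real n)))) =
        of_real (\<Sum>n. b n * exp (- x * sqrt (real n)))"
    proof -
      have "summable (\<lambda>n. b n * exp (- x * sqrt (real n)))"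
        using summable_exp_sqrt[OF x(2) summable_b]
        by (intro summable_norm_cancel[of "\<lambda>n. b n * exp (- x * sqrt (real n))"]) (simp add: abs_mult)
      hence "of_real (\<Sum>n. b n * exp (- x * sqrt (real n))) = (\<Sum>n. of_real (b n * exp (- x * sqrt (real n))) :: complex)"
        by (rule suminf_of_real)
      thus ?thesis by (simp add: x flip: exp_of_real)
    qed
    ultimately show "f z = 0"
      using x(1) sqrt_exponential_sum_real[OF x(2)] by (simp add: f_def)
  qed (fact S)
  thus ?thesis by (simp add: f_def)
qed

section \<open>Laplace transform of the partial sums\<close>

text \<open>In the variable \<open>y = sqrt x\<close> the jump \<open>b n\<close> sits at
  \<open>sqrt n\<close>, matching the exponentials \<open>exp (- w * sqrt n)\<close>.\<close>

definition square_partial_sum :: "real \<Rightarrow> real" where "square_partial_sum y = (\<Sum>n | 1 \<le> n \<and> real n \<le> y\<^sup>2. b n)"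

text \<open>Each \<open>b n\<close> is switched on at \<open>y = sqrt n\<close>. The finite sum is
  rewritten as a series of step functions for termwise integration.\<close>

lemma square_partial_sum_eq_suminf:
  assumes "y \<ge> 0"
  shows "square_partial_sum y = (\<Sum>n. b n * indicator {sqrt (real n)..} y)"
    and "summable (\<lambda>n. \<bar>b n\<bar> * indicator {sqrt (real n)..} y)"
proof -
  have le: "sqrt (real n) \<le> y \<longleftrightarrow> real n \<le> y\<^sup>2" for n
    using assms real_sqrt_le_iff[of "real n" "y\<^sup>2"] by simp
  have fin: "finite {n. 1 \<le> n \<and> real n \<le> y\<^sup>2}"
    by (rule finite_subset[of _ "{..nat \<lfloor>y\<^sup>2\<rfloor>}"]) (auto simp: le_nat_floor)
  have zero: "b n = 0 \<or> \<not> sqrt (real n) \<le> y" if "n \<notin> {n. 1 \<le> n \<and> real n \<le> y\<^sup>2}" for n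
    using that b0 by (cases n) (auto simp: le simp del: of_nat_Suc)
  have "(\<Sum>n. b n * indicator {sqrt (real n)..} y) =
      (\<Sum>n | 1 \<le> n \<and> real n \<le> y\<^sup>2. b n * indicator {sqrt (real n)..} y)"
    using zero by (intro suminf_finite[OF fin]) (auto simp: indicator_def)
  also have "\<dots> = square_partial_sum y"
    unfolding square_partial_sum_def by (intro sum.cong) (auto simp: indicator_def le)
  finally show "square_partial_sum y = (\<Sum>n. b n * indicator {sqrt (real n)..} y)" ..
  show "summable (\<lambda>n. \<bar>b n\<bar> * indicator {sqrt (real n)..} y)"
    using zero by (intro summable_finite[OF fin]) (auto simp: indicator_def)
qed

text \<open>The step function starting at \<open>sqrt n\<close> has Laplace transform
  \<open>exp (- w * sqrt n) / w\<close>; the division by \<open>w\<close> cancels the factor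
  \<open>w\<close> in front of the dual series.\<close>

lemma has_bochner_integral_square_partial_sum:
  assumes w: "Re w > 0"
  shows "has_bochner_integral lborel (\<lambda>y. indicator {0..} y *\<^sub>R (square_partial_sum y *\<^sub>R exp (- w * of_real y)))
           (of_real dual_const * dual_series w)"
proof -
  define f where "f n y = of_real (b n) * (indicator {sqrt (real n)..} y *\<^sub>R exp (- w * of_real y))" for n y
  have hb: "has_bochner_integral lborel (f n) (of_real (b n) * (exp (- w * of_real (sqrt (real n))) / w))" for n
    unfolding f_def by (intro has_bochner_integral_mult_right has_bochner_integral_exp_Ici w)
  have norm_f: "norm (f n y) = \<bar>b n\<bar> * (indicator {sqrt (real n)..} y *\<^sub>R exp (- Re w * y))" for n y
    by (simp add: f_def norm_mult)
  have "has_bochner_integral lborel (\<lambda>y. norm (f n y)) (\<bar>b n\<bar> * (exp (- Re w * sqrt (real n)) / Re w))" for n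
    unfolding norm_f by (intro has_bochner_integral_mult_right has_bochner_integral_exp_Ici_real w)
  hence norm_int: "(\<integral>y. norm (f n y) \<partial>lborel) = \<bar>b n\<bar> * (exp (- Re w * sqrt (real n)) / Re w)" for n
    by (simp add: has_bochner_integral_iff)
  have f_neg: "f n y = 0" if "y < 0" for n y
    using that order.trans[of 0 "sqrt (real n)" y] by (auto simp: f_def indicator_def)
  have a1: "integrable lborel (f n)" for n
    using hb by (simp add: has_bochner_integral_iff)
  have a2: "AE y in lborel. summable (\<lambda>n. norm (f n y))"
  proof (intro always_eventually allI)
    fix y :: real
    show "summable (\<lambda>n. norm (f n y))"
    proof (cases "y < 0")
      case False
      hence "summable (\<lambda>n. (\<bar>b n\<bar> * indicator {sqrt (real n)..} y) * exp (- Re w * y))"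
        by (intro summable_mult2 square_partial_sum_eq_suminf) auto
      thus ?thesis by (simp add: norm_f mult_ac)
    qed (simp add: f_neg)
  qed
  have a3: "summable (\<lambda>n. \<integral>y. norm (f n y) \<partial>lborel)"
    using summable_divide[OF summable_exp_sqrt[OF w summable_b], of "Re w"]
    unfolding norm_int by simp
  have ptw: "(\<Sum>n. f n y) = indicator {0..} y *\<^sub>R (square_partial_sum y *\<^sub>R exp (- w * of_real y))" for y
  proof (cases "y < 0")
    case False
    hence y: "y \<ge> 0" by simp
    have "summable (\<lambda>n. b n * indicator {sqrt (real n)..} y)"
      using square_partial_sum_eq_suminf(2)[OF y] by (intro summable_norm_cancel[of "\<lambda>n. b n * _ n"]) (simp add: abs_mult)
    hence "(\<lambda>n. of_real (b n * indicator {sqrt (real n)..} y) * exp (- w * of_real y)) sums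
       (of_real (square_partial_sum y) * exp (- w * of_real y))"
      unfolding square_partial_sum_eq_suminf(1)[OF y] by (intro sums_mult2 sums_of_real summable_sums)
    moreover have "of_real (b n * indicator {sqrt (real n)..} y) * exp (- w * of_real y) = f n y" for n
      by (simp add: f_def indicator_def)
    ultimately show ?thesis using y by (simp add: sums_iff scaleR_conv_of_real)
  qed (simp add: f_neg)
  have "(\<integral>y. (\<Sum>n. f n y) \<partial>lborel) = (\<Sum>n. of_real (b n) * (exp (- w * of_real (sqrt (real n))) / w))"
    using integral_suminf[OF a1 a2 a3] hb by (simp only: has_bochner_integral_iff)
  also have "\<dots> = (\<Sum>n. of_real (b n) * exp (- w * of_real (sqrt (real n)))) / w"
  proof -
    have "summable (\<lambda>n. norm (of_real (b n) * exp (- w * of_real (sqrt (real n)))))"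
      using summable_exp_sqrt[OF w summable_b] by (simp add: norm_mult)
    from suminf_divide[OF summable_norm_cancel[OF this], of w] show ?thesis by simp
  qed
  also have "\<dots> = of_real dual_const * dual_series w"
    using w by (subst sqrt_exponential_sum_complex) auto
  finally show ?thesis
    using integrable_suminf[OF a1 a2 a3] by (simp add: has_bochner_integral_iff ptw)
qed

section \<open>Boundary behaviour of the dual series\<close>

text \<open>If \<open>lam * n\<close> keeps the distance \<open>2 * \<eta> * n\<close> from
  \<open>\<mu>^2 / 4\<close>, then for small \<delta> every base has modulus at least
  \<open>\<eta> * n\<close>. The series is bounded uniformly in \<delta>, so the factor
  \<open>\<delta> powr p\<close> sends it to \<open>0\<close>. This serves for the frequency
  \<open>0\<close> and for the terms that stay regular at a singularity.\<close>

lemma tendsto_shifted_series_0: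
  fixes c :: "nat \<Rightarrow> real"
  assumes "\<eta> > 0" "c 0 = 0" "summable (\<lambda>n. \<bar>c n\<bar> * real n powr - p)"
    and sep: "\<And>n. c n \<noteq> 0 \<Longrightarrow> \<bar>lam * real n - \<mu>\<^sup>2 / 4\<bar> \<ge> 2 * \<eta> * real n"
  shows "((\<lambda>\<delta>. of_real (\<delta> powr p) *
           (\<Sum>n. of_real (c n) * ((of_real \<delta> + \<i> * of_real \<mu>)\<^sup>2 / 4 + of_real (lam * real n)) powr of_real (- p)))
          \<longlongrightarrow> (0 :: complex)) (at_right 0)"
    and "\<forall>\<^sub>F \<delta> in at_right 0. summable
           (\<lambda>n. of_real (c n) * ((of_real \<delta> + \<i> * of_real \<mu>)\<^sup>2 / 4 + of_real (lam * real n)) powr (of_real (- p) :: complex))"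
proof -
  define f where "f \<delta> n = of_real (c n) *
     ((of_real \<delta> + \<i> * of_real \<mu>)\<^sup>2 / 4 + of_real (lam * real n)) powr (of_real (- p) :: complex)" for \<delta> n
  define D where "D = (\<Sum>n. \<eta> powr - p * (\<bar>c n\<bar> * real n powr - p))"
  have sumD: "summable (\<lambda>n. \<eta> powr - p * (\<bar>c n\<bar> * real n powr - p))"
    by (intro summable_mult assms)
  \<comment> \<open>The perturbation caused by \<delta> must stay below \<eta>, hence below
    \<open>\<eta> * n\<close> for \<open>n \<ge> 1\<close>; it then uses up at most half of the
    gap.\<close>
  have small: "\<forall>\<^sub>F \<delta> in at_right (0::real). \<delta> > 0 \<and> \<delta>\<^sup>2 / 4 + \<delta> * \<bar>\<mu>\<bar> / 2 < \<eta>"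
  proof (rule eventually_conj)
    have "((\<lambda>\<delta>. \<delta>\<^sup>2 / 4 + \<delta> * \<bar>\<mu>\<bar> / 2) \<longlongrightarrow> 0) (at_right (0::real))"
      by (auto intro!: tendsto_eq_intros)
    thus "\<forall>\<^sub>F \<delta> in at_right 0. \<delta>\<^sup>2 / 4 + \<delta> * \<bar>\<mu>\<bar> / 2 < \<eta>"
      using assms(1) by (rule order_tendstoD)
  qed (rule eventually_at_right_less)
  have bound: "norm (f \<delta> n) \<le> \<eta> powr - p * (\<bar>c n\<bar> * real n powr - p)"
    if \<delta>: "\<delta> > 0" "\<delta>\<^sup>2 / 4 + \<delta> * \<bar>\<mu>\<bar> / 2 < \<eta>" for \<delta> n
  proof (cases "c n = 0")
    case False
    hence n: "n \<ge> 1" using assms(2) by (cases n) auto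
    have eq: "(of_real \<delta> + \<i> * of_real \<mu>)\<^sup>2 / 4 + of_real (lam * real n) =
        (of_real (lam * real n - \<mu>\<^sup>2 / 4) + (of_real (\<delta>\<^sup>2 / 4) + \<i> * of_real (\<delta> * \<mu> / 2)) :: complex)"
      by (simp add: power2_eq_square algebra_simps) (simp add: field_simps)
    have "norm (of_real (\<delta>\<^sup>2 / 4) + \<i> * of_real (\<delta> * \<mu> / 2) :: complex) \<le> \<delta>\<^sup>2 / 4 + \<delta> * \<bar>\<mu>\<bar> / 2"
      using norm_triangle_ineq[of "of_real (\<delta>\<^sup>2 / 4)" "\<i> * of_real (\<delta> * \<mu> / 2) :: complex"] \<delta>
      by (simp add: norm_mult norm_divide norm_power abs_mult del: of_real_divide of_real_mult of_real_power)
    moreover have "\<eta> \<le> \<eta> * real n" using n assms(1) by simp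
    ultimately have "norm ((of_real \<delta> + \<i> * of_real \<mu>)\<^sup>2 / 4 + of_real (lam * real n) :: complex) \<ge> \<eta> * real n"
      unfolding eq
      using norm_diff_ineq[of "of_real (lam * real n - \<mu>\<^sup>2 / 4)" "of_real (\<delta>\<^sup>2 / 4) + \<i> * of_real (\<delta> * \<mu> / 2) :: complex"]
        sep[OF False] \<delta>(2) unfolding norm_of_real by linarith
    hence "norm ((of_real \<delta> + \<i> * of_real \<mu>)\<^sup>2 / 4 + of_real (lam * real n) :: complex) powr - p \<le> (\<eta> * real n) powr - p"
      using n assms(1) p_pos by (intro powr_mono2') auto
    also have "\<dots> = \<eta> powr - p * real n powr - p"
      by (rule powr_mult)
    finally have "\<bar>c n\<bar> * norm ((of_real \<delta> + \<i> * of_real \<mu>)\<^sup>2 / 4 + of_real (lam * real n) :: complex) powr - p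
        \<le> \<bar>c n\<bar> * (\<eta> powr - p * real n powr - p)"
      by (intro mult_left_mono) auto
    thus ?thesis
      unfolding f_def by (subst norm_mult, subst norm_powr_real_powr') (simp_all add: mult_ac)
  qed (simp add: f_def)
  have summable_f: "summable (\<lambda>n. norm (f \<delta> n))"
    if \<delta>: "\<delta> > 0" "\<delta>\<^sup>2 / 4 + \<delta> * \<bar>\<mu>\<bar> / 2 < \<eta>" for \<delta>
    using bound[OF \<delta>] by (intro summable_comparison_test[OF _ sumD]) auto
  show "\<forall>\<^sub>F \<delta> in at_right 0. summable (\<lambda>n. of_real (c n) *
     ((of_real \<delta> + \<i> * of_real \<mu>)\<^sup>2 / 4 + of_real (lam * real n)) powr (of_real (- p) :: complex))"
    using small by eventually_elim (use summable_f in \<open>auto simp: f_def intro: summable_norm_cancel\<close>)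
  have "((\<lambda>\<delta>. of_real (\<delta> powr p) * (\<Sum>n. f \<delta> n)) \<longlongrightarrow> 0) (at_right 0)"
  proof (rule Lim_null_comparison)
    show "\<forall>\<^sub>F \<delta> in at_right 0. norm (of_real (\<delta> powr p) * (\<Sum>n. f \<delta> n)) \<le> \<delta> powr p * D"
      using small
    proof eventually_elim
      case (elim \<delta>)
      have "norm (\<Sum>n. f \<delta> n) \<le> (\<Sum>n. norm (f \<delta> n))"
        using elim by (intro summable_norm summable_f) auto
      also have "\<dots> \<le> D"
        unfolding D_def using elim by (intro suminf_le bound summable_f sumD) auto
      finally show ?case by (simp add: norm_mult mult_left_mono)
    qed
    have "((\<lambda>\<delta>. \<delta> powr p) \<longlongrightarrow> 0) (at_right (0::real))"
      using p_pos by real_asymp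
    thus "((\<lambda>\<delta>. \<delta> powr p * D) \<longlongrightarrow> 0) (at_right 0)"
      using tendsto_mult_left_zero by blast
  qed
  thus "((\<lambda>\<delta>. of_real (\<delta> powr p) *
           (\<Sum>n. of_real (c n) * ((of_real \<delta> + \<i> * of_real \<mu>)\<^sup>2 / 4 + of_real (lam * real n)) powr of_real (- p)))
          \<longlongrightarrow> (0 :: complex)) (at_right 0)"
    by (simp add: f_def)
qed

text \<open>At frequency \<open>0\<close> the gap is \<open>lam * n\<close> itself, so
  \<open>\<eta> = lam / 2\<close> works for all terms.\<close>

lemma tendsto_dual_series_0: "((\<lambda>\<delta>. of_real (\<delta> powr p) * dual_series (of_real \<delta>)) \<longlongrightarrow> 0) (at_right 0)"
proof -
  have "\<bar>lam * real n - 0\<^sup>2 / 4\<bar> \<ge> 2 * (lam / 2) * real n" for n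
    using lam_pos by simp
  from tendsto_shifted_series_0(1)[of "lam/2", OF _ B0 summable_B this] lam_pos
  show ?thesis by (simp add: dual_series_def)
qed

text \<open>Since \<open>\<mu>^2 / 4 = lam * m\<close>, the base of index \<open>m\<close> factors
  as \<delta> times \<open>(\<delta> + 2 * \<i> * \<mu>) / 4\<close>. After multiplication by
  \<open>\<delta> powr p\<close> this term has the stated limit, and all others tend to
  \<open>0\<close> together.\<close>

lemma tendsto_dual_series_singularity:
  assumes m: "m \<ge> 1" and \<mu>: "\<mu> = 2 * sqrt (lam * real m)"
  shows "((\<lambda>\<delta>. of_real (\<delta> powr p) * dual_series (of_real \<delta> + \<i> * of_real \<mu>))
           \<longlongrightarrow> of_real (B m) * (\<i> * of_real (\<mu> / 2)) powr of_real (- p)) (at_right 0)"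
proof -
  define c where "c = B(m := 0)"
  define f where "f a \<delta> n = of_real (a n) *
     ((of_real \<delta> + \<i> * of_real \<mu>)\<^sup>2 / 4 + of_real (lam * real n)) powr (of_real (- p) :: complex)"
    for a :: "nat \<Rightarrow> real" and \<delta> n
  have \<mu>_pos: "\<mu> > 0" using m lam_pos by (simp add: \<mu>)
  have \<mu>2: "\<mu>\<^sup>2 = 4 * (lam * real m)"
    using lam_pos by (simp add: \<mu> power_mult_distrib)
  \<comment> \<open>Integers \<open>n\<close> and \<open>m\<close> that differ satisfy
    \<open>n \<le> (m + 1) * \<bar>n - m\<bar>\<close>, which yields a gap proportional to
    \<open>n\<close>.\<close>
  have sep: "\<bar>lam * real n - \<mu>\<^sup>2 / 4\<bar> \<ge> 2 * (lam / (2 * (real m + 1))) * real n" if "c n \<noteq> 0" for n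
  proof -
    have "n \<noteq> m" using that by (auto simp: c_def)
    have "real n \<le> (real m + 1) * \<bar>real n - real m\<bar>"
    proof (cases "n < m")
      case True
      have "real n \<le> (real m + 1) * 1" using True by simp
      also have "\<dots> \<le> (real m + 1) * \<bar>real n - real m\<bar>"
        using True by (intro mult_left_mono) auto
      finally show ?thesis .
    next
      case False
      hence "real n \<ge> real m + 1" using \<open>n \<noteq> m\<close> by simp
      hence "real m * (real m + 1) \<le> real m * real n" by (intro mult_left_mono) auto
      thus ?thesis using False by (simp add: algebra_simps)
    qed
    hence "lam * real n \<le> lam * ((real m + 1) * \<bar>real n - real m\<bar>)"
      using lam_pos by (intro mult_left_mono) auto
    hence "lam * real n / (real m + 1) \<le> lam * \<bar>real n - real m\<bar>"
      by (simp add: pos_divide_le_eq mult_ac)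
    also have "\<dots> = \<bar>lam * real n - \<mu>\<^sup>2 / 4\<bar>"
      using lam_pos by (simp add: \<mu>2 abs_mult flip: right_diff_distrib)
    finally show ?thesis using lam_pos by (simp add: field_simps)
  qed
  have "\<bar>c n\<bar> * real n powr - p \<le> \<bar>B n\<bar> * real n powr - p" for n
    by (simp add: c_def)
  hence sc: "summable (\<lambda>n. \<bar>c n\<bar> * real n powr - p)"
    by (intro summable_comparison_test[OF _ summable_B]) (auto simp: abs_mult)
  have c0: "c 0 = 0" using B0 by (simp add: c_def)
  have \<eta>: "lam / (2 * (real m + 1)) > 0" using lam_pos by simp
  have c_lim: "((\<lambda>\<delta>. of_real (\<delta> powr p) * (\<Sum>n. f c \<delta> n)) \<longlongrightarrow> 0) (at_right 0)"
    "\<forall>\<^sub>F \<delta> in at_right 0. summable (f c \<delta>)"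
    unfolding f_def by (rule tendsto_shifted_series_0[OF \<eta> c0 sc sep]; assumption)+
  have main: "((\<lambda>\<delta>. of_real (B m) * ((of_real \<delta> + 2 * \<i> * of_real \<mu>) / 4) powr (of_real (- p) :: complex))
         \<longlongrightarrow> of_real (B m) * ((of_real 0 + 2 * \<i> * of_real \<mu>) / 4) powr of_real (- p)) (at_right (0::real))"
    using \<mu>_pos by (intro tendsto_intros) (auto simp: complex_nonpos_Reals_iff)
  have "((\<lambda>\<delta>. of_real (B m) * ((of_real \<delta> + 2 * \<i> * of_real \<mu>) / 4) powr of_real (- p)
           + of_real (\<delta> powr p) * (\<Sum>n. f c \<delta> n))
         \<longlongrightarrow> of_real (B m) * ((of_real 0 + 2 * \<i> * of_real \<mu>) / 4) powr of_real (- p) + 0) (at_right 0)"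
    by (intro tendsto_add main c_lim(1))
  moreover have "\<forall>\<^sub>F \<delta> in at_right 0.
       of_real (B m) * ((of_real \<delta> + 2 * \<i> * of_real \<mu>) / 4) powr of_real (- p)
           + of_real (\<delta> powr p) * (\<Sum>n. f c \<delta> n) = of_real (\<delta> powr p) * dual_series (of_real \<delta> + \<i> * of_real \<mu>)"
    using c_lim(2) eventually_at_right_less
  proof eventually_elim
    case (elim \<delta>)
    have "(\<lambda>n. (if n = m then f B \<delta> m else 0) + f c \<delta> n) sums (f B \<delta> m + (\<Sum>n. f c \<delta> n))"
      by (intro sums_add summable_sums elim(1) sums_single[of m "\<lambda>_. f B \<delta> m"])
    also have "(\<lambda>n. (if n = m then f B \<delta> m else 0) + f c \<delta> n) = f B \<delta>"
      by (auto simp: c_def f_def)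
    finally have "dual_series (of_real \<delta> + \<i> * of_real \<mu>) = f B \<delta> m + (\<Sum>n. f c \<delta> n)"
      by (simp add: dual_series_def f_def[abs_def] sums_iff)
    moreover have "of_real (\<delta> powr p) * f B \<delta> m =
        of_real (B m) * ((of_real \<delta> + 2 * \<i> * of_real \<mu>) / 4) powr of_real (- p)"
    proof -
      have "(of_real \<delta> + \<i> * of_real \<mu>)\<^sup>2 / 4 + of_real (lam * real m) =
         (of_real \<delta> * ((of_real \<delta> + 2 * \<i> * of_real \<mu>) / 4) :: complex)"
      proof -
        have "of_real (lam * real m) = (of_real \<mu>)\<^sup>2 / (4 :: complex)"
          by (simp add: \<mu>2 flip: of_real_power)
        moreover have "(of_real \<delta> + \<i> * of_real \<mu>)\<^sup>2 =
            of_real \<delta> * (of_real \<delta> + 2 * \<i> * of_real \<mu>) - (of_real \<mu> :: complex)\<^sup>2"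
          by (simp add: power2_eq_square algebra_simps)
        ultimately show ?thesis by (simp add: diff_divide_distrib)
      qed
      \<comment> \<open>The principal power is multiplicative here because the factor \<delta> is a
        positive real.\<close>
      also have "\<dots> powr of_real (- p) = of_real \<delta> powr of_real (- p) *
          ((of_real \<delta> + 2 * \<i> * of_real \<mu>) / 4) powr of_real (- p)"
        using elim(2) by (intro powr_times_real_left) auto
      also have "of_real \<delta> powr of_real (- p) = (of_real (\<delta> powr - p) :: complex)"
        using elim(2) by (intro powr_of_real) auto
      finally show ?thesis
        using elim(2) by (simp add: f_def powr_minus)
    qed
    ultimately show ?case by (simp add: ring_distribs)
  qed
  ultimately show ?thesis
    by (auto dest: Lim_transform_eventually simp: field_simps)
qed

section \<open>Refutation of a one-sided bound\<close>

text \<open>Under the contrary bound, the Laplace integral with a weight between \<open>0\<close>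
  and \<open>2\<close> is at most \<open>2 * \<epsilon> * Gamma p * \<delta> powr - p\<close> plus a
  constant. The singularity at \<mu> makes it asymptotic to
  \<open>norm z * \<delta> powr - p\<close>, which is larger.\<close>

lemma partial_sum_frequently_large:
  assumes m: "m \<ge> 1" "B m \<noteq> 0"
  shows "\<exists>\<epsilon>>0. \<exists>\<^sub>F x in at_top. (\<Sum>n | 1 \<le> n \<and> real n \<le> x. b n) > \<epsilon> * x powr (k / 2 - 1 / 4)"
proof -
  define \<mu> where "\<mu> = 2 * sqrt (lam * real m)"
  \<comment> \<open>The limit of \<open>\<delta> powr p\<close> times the Laplace transform at
    \<open>\<delta> + \<i> * \<mu>\<close>; it is nonzero because \<open>B m\<close> is.\<close>
  define z where "z = of_real dual_const * (of_real (B m) * (\<i> * of_real (\<mu> / 2)) powr (of_real (- p) :: complex))"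
  \<comment> \<open>The phase that rotates \<open>z\<close> to the positive real
    \<open>norm z\<close>.\<close>
  define u where "u = cnj z / of_real (norm z)"
  \<comment> \<open>Chosen so that \<open>2 * \<epsilon> * Gamma p\<close> is half of
    \<open>norm z\<close>.\<close>
  define \<epsilon> where "\<epsilon> = norm z / (4 * Gamma p)"
  have "\<mu> > 0" using m lam_pos by (simp add: \<mu>_def)
  hence "z \<noteq> 0" using m dual_const_pos by (auto simp: z_def)
  hence norm_z: "norm z > 0" by simp
  have u: "norm u = 1" using norm_z by (simp add: u_def norm_divide)
  have uz: "u * z = of_real (norm z)"
    using norm_z by (simp add: u_def complex_norm_square[symmetric] power2_eq_square mult.commute[of "cnj z"])
  have Gp: "Gamma p > 0" using p_pos by (rule Gamma_real_pos)
  have \<epsilon>_pos: "\<epsilon> > 0" using norm_z Gp by (simp add: \<epsilon>_def)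
  have "\<not> (\<forall>\<^sub>F x in at_top. (\<Sum>n | 1 \<le> n \<and> real n \<le> x. b n) \<le> \<epsilon> * x powr (k / 2 - 1 / 4))"
  proof
    assume "\<forall>\<^sub>F x in at_top. (\<Sum>n | 1 \<le> n \<and> real n \<le> x. b n) \<le> \<epsilon> * x powr (k / 2 - 1 / 4)"
    then obtain X where X: "\<And>x. x \<ge> X \<Longrightarrow> (\<Sum>n | 1 \<le> n \<and> real n \<le> x. b n) \<le> \<epsilon> * x powr (k / 2 - 1 / 4)"
      by (auto simp: eventually_at_top_linorder)
    define Y where "Y = max 1 X"
    have "Y \<ge> 0" by (simp add: Y_def)
    \<comment> \<open>On \<open>{0..Y}\<close>, where the assumed bound may fail, the crude bound
      \<open>D\<close> is enough: its contribution to the integral does not depend on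
      \<delta>.\<close>
    define D where "D = (\<Sum>n\<in>{n. 1 \<le> n \<and> real n \<le> Y\<^sup>2}. \<bar>b n\<bar>)"
    have "D \<ge> 0" unfolding D_def by (intro sum_nonneg) auto
    have fin: "finite {n. 1 \<le> n \<and> real n \<le> Y\<^sup>2}"
      by (rule finite_subset[of _ "{..nat \<lfloor>Y\<^sup>2\<rfloor>}"]) (auto simp: le_nat_floor)
    have square_partial_sum_le: "square_partial_sum y \<le> \<epsilon> * y powr (p - 1) + D * indicator {0..Y} y" if y: "y \<ge> 0" for y
    proof (cases "y \<le> Y")
      case True
      have "square_partial_sum y \<le> (\<Sum>n | 1 \<le> n \<and> real n \<le> y\<^sup>2. \<bar>b n\<bar>)"
        unfolding square_partial_sum_def by (intro sum_mono) auto
      also have "\<dots> \<le> D"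
        unfolding D_def
      proof (intro sum_mono2 fin)
        have "y\<^sup>2 \<le> Y\<^sup>2" using True y by (intro power_mono)
        thus "{n. 1 \<le> n \<and> real n \<le> y\<^sup>2} \<subseteq> {n. 1 \<le> n \<and> real n \<le> Y\<^sup>2}" by auto
      qed auto
      finally show ?thesis using True y \<epsilon>_pos by (simp add: add_increasing)
    next
      case False
      hence "1 \<le> y" "X \<le> y" by (auto simp: Y_def)
      hence "y\<^sup>2 \<ge> X" using self_le_power[of y 2] by simp
      from X[OF this] have "square_partial_sum y \<le> \<epsilon> * (y\<^sup>2) powr (k / 2 - 1 / 4)"
        by (simp add: square_partial_sum_def)
      also have "(y\<^sup>2) powr (k / 2 - 1 / 4) = y powr (p - 1)"
        using False by (simp add: Y_def p_eq powr_powr flip: powr_numeral)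
      finally show ?thesis using False by simp
    qed
    have bound: "Re (of_real dual_const * dual_series (of_real \<delta>) + u * (of_real dual_const * dual_series (of_real \<delta> + \<i> * of_real \<mu>)))
        \<le> 2 * \<epsilon> * Gamma p * \<delta> powr - p + 2 * D * Y" if \<delta>: "\<delta> > 0" for \<delta>
    proof -
      \<comment> \<open>The weight is nonnegative because \<open>u\<close> has modulus
        \<open>1\<close>; this is what allows a one-sided bound on the partial sums to be
        integrated. Its two summands produce the Laplace transforms at \<delta> and at
        \<open>\<delta> + \<i> * \<mu>\<close>.\<close>
      define W where "W y = 1 + Re (u * exp (- \<i> * of_real (\<mu> * y)))" for y
      have W: "0 \<le> W y" "W y \<le> 2" for y
        using abs_Re_le_cmod[of "u * exp (- \<i> * of_real (\<mu> * y))"] u by (auto simp: W_def norm_mult)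
      have i1: "has_bochner_integral lborel
          (\<lambda>y. indicator {0..} y *\<^sub>R (square_partial_sum y *\<^sub>R exp (- of_real \<delta> * of_real y))
             + u * (indicator {0..} y *\<^sub>R (square_partial_sum y *\<^sub>R exp (- (of_real \<delta> + \<i> * of_real \<mu>) * of_real y))))
          (of_real dual_const * dual_series (of_real \<delta>) + u * (of_real dual_const * dual_series (of_real \<delta> + \<i> * of_real \<mu>)))"
        using \<delta> by (intro has_bochner_integral_add has_bochner_integral_mult_right has_bochner_integral_square_partial_sum) auto
      have eq: "Re (indicator {0..} y *\<^sub>R (square_partial_sum y *\<^sub>R exp (- of_real \<delta> * of_real y))
             + u * (indicator {0..} y *\<^sub>R (square_partial_sum y *\<^sub>R exp (- (of_real \<delta> + \<i> * of_real \<mu>) * of_real y))))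
           = indicator {0..} y * (square_partial_sum y * exp (- \<delta> * y) * W y)" for y
      proof -
        have e1: "exp (- of_real \<delta> * of_real y) = (of_real (exp (- \<delta> * y)) :: complex)"
          by (simp flip: exp_of_real)
        have e2: "exp (- (of_real \<delta> + \<i> * of_real \<mu>) * of_real y) =
            of_real (exp (- \<delta> * y)) * exp (- \<i> * of_real (\<mu> * y))"
          by (simp add: algebra_simps flip: exp_of_real exp_add)
        have "indicator {0..} y *\<^sub>R (square_partial_sum y *\<^sub>R exp (- of_real \<delta> * of_real y))
             + u * (indicator {0..} y *\<^sub>R (square_partial_sum y *\<^sub>R exp (- (of_real \<delta> + \<i> * of_real \<mu>) * of_real y)))
           = of_real (indicator {0..} y * (square_partial_sum y * exp (- \<delta> * y))) * (1 + u * exp (- \<i> * of_real (\<mu> * y)))"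
          unfolding e1 e2 by (simp add: scaleR_conv_of_real algebra_simps del: exp_of_real)
        thus ?thesis by (simp only: Re_of_real_mult W_def) simp
      qed
      have i2: "has_bochner_integral lborel (\<lambda>y. indicator {0..} y * (square_partial_sum y * exp (- \<delta> * y) * W y))
          (Re (of_real dual_const * dual_series (of_real \<delta>) + u * (of_real dual_const * dual_series (of_real \<delta> + \<i> * of_real \<mu>))))"
        using has_bochner_integral_bounded_linear[OF bounded_linear_Re i1] unfolding eq .
      have "has_bochner_integral lborel (\<lambda>y. indicator {0<..} y *\<^sub>R (y powr (p - 1) * exp (- \<delta> * y)))
           (Gamma p * \<delta> powr (- p))"
        using \<delta> p_pos by (intro has_bochner_integral_powr_exp)
      moreover have "has_bochner_integral lborel (\<lambda>y. indicator {0..Y} y) (Y - 0 :: real)"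
        using has_bochner_integral_real_indicator[of "{0..Y}" lborel] \<open>Y \<ge> 0\<close> by simp
      ultimately have i3: "has_bochner_integral lborel
          (\<lambda>y. 2 * \<epsilon> * (indicator {0<..} y *\<^sub>R (y powr (p - 1) * exp (- \<delta> * y))) + 2 * D * indicator {0..Y} y)
          (2 * \<epsilon> * (Gamma p * \<delta> powr (- p)) + 2 * D * (Y - 0))"
        by (intro has_bochner_integral_add has_bochner_integral_mult_right) auto
      have "indicator {0..} y * (square_partial_sum y * exp (- \<delta> * y) * W y) \<le>
          2 * \<epsilon> * (indicator {0<..} y *\<^sub>R (y powr (p - 1) * exp (- \<delta> * y))) + 2 * D * indicator {0..Y} y" for y
      proof (cases "y \<ge> 0")
        case True
        have "square_partial_sum y * exp (- \<delta> * y) * W y \<le> (\<epsilon> * y powr (p - 1) + D * indicator {0..Y} y) * exp (- \<delta> * y) * W y"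
          using square_partial_sum_le[OF True] W by (intro mult_right_mono) auto
        also have "\<dots> \<le> (\<epsilon> * y powr (p - 1) + D * indicator {0..Y} y) * exp (- \<delta> * y) * 2"
          using W \<epsilon>_pos \<open>D \<ge> 0\<close> by (intro mult_left_mono) auto
        also have "\<dots> = 2 * \<epsilon> * (y powr (p - 1) * exp (- \<delta> * y)) + 2 * D * indicator {0..Y} y * exp (- \<delta> * y)"
          by (simp add: algebra_simps)
        also have "\<dots> \<le> 2 * \<epsilon> * (y powr (p - 1) * exp (- \<delta> * y)) + 2 * D * indicator {0..Y} y"
          using \<delta> True \<open>D \<ge> 0\<close> by (intro add_left_mono mult_left_le) auto
        also have "y powr (p - 1) * exp (- \<delta> * y) = indicator {0<..} y *\<^sub>R (y powr (p - 1) * exp (- \<delta> * y))"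
          using True by (cases "y = 0") auto
        finally show ?thesis using True by simp
      qed (auto simp: indicator_def)
      hence "Re (of_real dual_const * dual_series (of_real \<delta>) + u * (of_real dual_const * dual_series (of_real \<delta> + \<i> * of_real \<mu>)))
         \<le> 2 * \<epsilon> * (Gamma p * \<delta> powr (- p)) + 2 * D * (Y - 0)"
        using i2 i3 integral_mono[of lborel "\<lambda>y. indicator {0..} y * (square_partial_sum y * exp (- \<delta> * y) * W y)"
           "\<lambda>y. 2 * \<epsilon> * (indicator {0<..} y *\<^sub>R (y powr (p - 1) * exp (- \<delta> * y))) + 2 * D * indicator {0..Y} y"]
        by (simp only: has_bochner_integral_iff)
      thus ?thesis by simp
    qed
    \<comment> \<open>After scaling by \<open>\<delta> powr p\<close> the part at frequency
      \<open>0\<close> disappears and only \<open>u * z = norm z\<close> is left.\<close>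
    have "((\<lambda>\<delta>. Re (of_real dual_const * (of_real (\<delta> powr p) * dual_series (of_real \<delta>))
          + u * (of_real dual_const * (of_real (\<delta> powr p) * dual_series (of_real \<delta> + \<i> * of_real \<mu>)))))
        \<longlongrightarrow> Re (of_real dual_const * 0 + u * z)) (at_right 0)"
      unfolding z_def
      by (intro tendsto_intros tendsto_dual_series_0 tendsto_dual_series_singularity m \<mu>_def)
    hence lim1: "((\<lambda>\<delta>. \<delta> powr p * Re (of_real dual_const * dual_series (of_real \<delta>) + u * (of_real dual_const * dual_series (of_real \<delta> + \<i> * of_real \<mu>))))
        \<longlongrightarrow> norm z) (at_right 0)"
    proof -
      have "Re (of_real dual_const * (of_real (\<delta> powr p) * dual_series (of_real \<delta>))
          + u * (of_real dual_const * (of_real (\<delta> powr p) * dual_series (of_real \<delta> + \<i> * of_real \<mu>)))) =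
          \<delta> powr p * Re (of_real dual_const * dual_series (of_real \<delta>) + u * (of_real dual_const * dual_series (of_real \<delta> + \<i> * of_real \<mu>)))" for \<delta>
        unfolding Re_of_real_mult[symmetric] by (simp only: ring_distribs mult_ac)
      with \<open>(_ \<longlongrightarrow> Re (of_real dual_const * 0 + u * z)) (at_right 0)\<close> show ?thesis by (simp add: uz)
    qed
    have lim2: "((\<lambda>\<delta>. 2 * \<epsilon> * Gamma p + 2 * D * Y * \<delta> powr p) \<longlongrightarrow> 2 * \<epsilon> * Gamma p) (at_right 0)"
    proof -
      have "((\<lambda>\<delta>. \<delta> powr p) \<longlongrightarrow> 0) (at_right (0::real))"
        using p_pos by real_asymp
      from tendsto_add[OF tendsto_const[of "2 * \<epsilon> * Gamma p"] tendsto_mult[OF tendsto_const[of "2 * D * Y"] this]]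
      show ?thesis by simp
    qed
    have "norm z \<le> 2 * \<epsilon> * Gamma p"
    proof (rule tendsto_le[OF _ lim2 lim1])
      show "\<forall>\<^sub>F \<delta> in at_right 0. \<delta> powr p * Re (of_real dual_const * dual_series (of_real \<delta>) + u * (of_real dual_const * dual_series (of_real \<delta> + \<i> * of_real \<mu>)))
         \<le> 2 * \<epsilon> * Gamma p + 2 * D * Y * \<delta> powr p"
        using eventually_at_right_less[of "0::real"]
      proof eventually_elim
        case (elim \<delta>)
        have "\<delta> powr p * Re (of_real dual_const * dual_series (of_real \<delta>) + u * (of_real dual_const * dual_series (of_real \<delta> + \<i> * of_real \<mu>)))
          \<le> \<delta> powr p * (2 * \<epsilon> * Gamma p * \<delta> powr - p + 2 * D * Y)"
          by (intro mult_left_mono bound elim) auto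
        also have "\<dots> = 2 * \<epsilon> * Gamma p * (\<delta> powr p * \<delta> powr - p) + 2 * D * Y * \<delta> powr p"
          by (simp add: algebra_simps)
        also have "\<delta> powr p * \<delta> powr - p = 1" using elim by (simp flip: powr_add)
        finally show ?case by simp
      qed
    qed auto
    thus False using norm_z Gp by (simp add: \<epsilon>_def)
  qed
  thus ?thesis using \<epsilon>_pos by (auto simp: not_eventually not_le)
qed

text \<open>By this symmetry the upper oscillation result, applied to \<open>- b\<close>, also gives
  the lower one.\<close>

lemma theta_transformation_uminus:
  "theta_transformation (\<lambda>n. - b n) (\<lambda>n. - B n) k lam C p"
proof
  fix v :: real assume v: "v > 0"
  have "summable (\<lambda>n. norm (b n * exp (- real n / v)))"
    using summable_exp_linear[OF _ summable_b, of "1 / v"] v by (simp add: abs_mult)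
  moreover have "summable (\<lambda>n. norm (B n * exp (- lam * real n * v)))"
    using summable_exp_linear[OF _ summable_B, of "lam * v"] v lam_pos by (simp add: abs_mult mult_ac)
  ultimately show "(\<Sum>n. - b n * exp (- real n / v)) = C * v powr k * (\<Sum>n. - B n * exp (- lam * real n * v))"
    using transformation[OF v] by (simp add: suminf_minus summable_norm_cancel)
qed (use k_pos lam_pos C_pos p_eq b0 B0 summable_b summable_B in auto)

end

section \<open>Growth of the Fourier coefficients\<close>

text \<open>Unconditional summability over the complex numbers is absolute summability. Index
  \<open>0\<close>, which the expansion leaves out, receives the coefficient \<open>0\<close> so
  that ordinary series can be used.\<close>

lemma fourier_expansion_sums:
  assumes "fourier_expansion a f" "Im \<tau> > 0"
  shows "(\<lambda>n. (if n = 0 then 0 else a n) * exp (2 * pi * \<i> * of_nat n * \<tau>)) sums f \<tau>"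
    and "summable (\<lambda>n. norm ((if n = 0 then 0 else a n) * exp (2 * pi * \<i> * of_nat n * \<tau>)))"
proof -
  define g where "g = (\<lambda>n. (if n = 0 then 0 else a n) * exp (2 * pi * \<i> * of_nat n * \<tau>))"
  have "((\<lambda>n. a n * exp (2 * pi * \<i> * of_nat n * \<tau>)) has_sum f \<tau>) {1..}"
    using assms by (simp add: fourier_expansion_def upper_half_plane_def)
  also have "?this \<longleftrightarrow> (g has_sum f \<tau>) UNIV"
    by (rule has_sum_cong_neutral) (auto simp: g_def)
  finally have hs: "(g has_sum f \<tau>) UNIV" .
  from has_sum_imp_sums[OF this]
  show "(\<lambda>n. (if n = 0 then 0 else a n) * exp (2 * pi * \<i> * of_nat n * \<tau>)) sums f \<tau>"
    unfolding g_def .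
  have "(\<lambda>n. norm (g n)) summable_on UNIV"
    using has_sum_imp_summable[OF hs] by (simp only: summable_on_iff_abs_summable_on_complex)
  from summable_on_imp_summable[OF this]
  show "summable (\<lambda>n. norm ((if n = 0 then 0 else a n) * exp (2 * pi * \<i> * of_nat n * \<tau>)))"
    unfolding g_def .
qed

lemma norm_exp_fourier: "norm (exp (2 * pi * \<i> * of_nat n * \<tau>)) = exp (- 2 * pi * real n * Im \<tau>)"
  by simp

lemma SL2Z_bottom_row:
  fixes c d :: int
  assumes "coprime c d"
  obtains \<gamma> :: "int ^ 2 ^ 2" where "\<gamma> \<in> SL2Z" "\<gamma> $ 2 $ 1 = c" "\<gamma> $ 2 $ 2 = d"
proof -
  from bezout_int[of c d] obtain u v where "u * c + v * d = 1"
    using assms by auto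
  hence "(vector [vector [v, - u], vector [c, d]] :: int ^ 2 ^ 2) \<in> SL2Z"
    by (simp add: SL2Z_def det_2 algebra_simps)
  thus ?thesis by (rule that) auto
qed

text \<open>The determinant condition reduces the numerator of the imaginary part to
  \<open>Im \<tau>\<close>.\<close>

lemma Im_moebius:
  fixes \<gamma> :: "int ^ 2 ^ 2"
  assumes "\<gamma> \<in> SL2Z"
  shows "Im (moebius \<gamma> \<tau>) = Im \<tau> / (norm (of_int (\<gamma> $ 2 $ 1) * \<tau> + of_int (\<gamma> $ 2 $ 2)))\<^sup>2"
proof -
  define a b c d :: real where "a = of_int (\<gamma> $ 1 $ 1)" "b = of_int (\<gamma> $ 1 $ 2)"
    "c = of_int (\<gamma> $ 2 $ 1)" "d = of_int (\<gamma> $ 2 $ 2)"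
  have "\<gamma> $ 1 $ 1 * \<gamma> $ 2 $ 2 - \<gamma> $ 1 $ 2 * \<gamma> $ 2 $ 1 = 1"
    using assms by (simp add: SL2Z_def det_2)
  hence "real_of_int (\<gamma> $ 1 $ 1 * \<gamma> $ 2 $ 2 - \<gamma> $ 1 $ 2 * \<gamma> $ 2 $ 1) = 1" by simp
  hence det: "a * d - b * c = 1" by (simp add: a_b_c_d_def)
  have "a * Im \<tau> * (c * Re \<tau> + d) - (a * Re \<tau> + b) * (c * Im \<tau>) = (a * d - b * c) * Im \<tau>"
    by (simp add: algebra_simps)
  also have "\<dots> = Im \<tau>" by (simp add: det)
  finally have num: "a * Im \<tau> * (c * Re \<tau> + d) - (a * Re \<tau> + b) * (c * Im \<tau>) = Im \<tau>" .
  have "moebius \<gamma> \<tau> = (of_real a * \<tau> + of_real b) / (of_real c * \<tau> + of_real d)"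
    by (simp add: moebius_def a_b_c_d_def)
  hence "Im (moebius \<gamma> \<tau>) = (a * Im \<tau> * (c * Re \<tau> + d) - (a * Re \<tau> + b) * (c * Im \<tau>)) /
      ((c * Re \<tau> + d)\<^sup>2 + (c * Im \<tau>)\<^sup>2)"
    by (simp add: Im_divide)
  also have "(c * Re \<tau> + d)\<^sup>2 + (c * Im \<tau>)\<^sup>2 = (norm (of_int (\<gamma> $ 2 $ 1) * \<tau> + of_int (\<gamma> $ 2 $ 2)))\<^sup>2"
    by (simp add: cmod_power2 a_b_c_d_def)
  finally show ?thesis by (simp only: num)
qed

text \<open>The expansion starts at \<open>n = 1\<close>, so \<open>f\<close> decays like
  \<open>exp (- 2 * pi * Im \<tau>)\<close>, which beats every power of
  \<open>Im \<tau>\<close>.\<close>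

lemma fourier_expansion_bounded_high:
  assumes f: "fourier_expansion a f" and y0: "y0 > 0"
  obtains M where "M \<ge> 0" "\<And>\<tau>. Im \<tau> \<ge> y0 \<Longrightarrow> norm (f \<tau>) * Im \<tau> powr r \<le> M"
proof -
  define c where "c n = (if n = 0 then 0 else a n)" for n
  define D where "D = (\<Sum>n. norm (c n) * exp (- 2 * pi * real n * y0))"
  have sumD: "summable (\<lambda>n. norm (c n) * exp (- 2 * pi * real n * y0))"
    using fourier_expansion_sums(2)[OF f, of "\<i> * of_real y0"] y0
    by (simp add: c_def norm_mult)
  have D: "D \<ge> 0" unfolding D_def by (intro suminf_nonneg sumD) auto
  \<comment> \<open>Each term is compared with its size at height \<open>y0\<close>; for
    \<open>n \<ge> 1\<close> the gain is at least that of \<open>n = 1\<close>.\<close>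
  have f_le: "norm (f \<tau>) \<le> exp (- 2 * pi * (Im \<tau> - y0)) * D" if \<tau>: "Im \<tau> \<ge> y0" for \<tau>
  proof -
    have pos: "Im \<tau> > 0" using \<tau> y0 by simp
    have "norm (f \<tau>) = norm (\<Sum>n. c n * exp (2 * pi * \<i> * of_nat n * \<tau>))"
      using fourier_expansion_sums(1)[OF f pos] by (simp add: c_def sums_iff)
    also have "\<dots> \<le> (\<Sum>n. norm (c n * exp (2 * pi * \<i> * of_nat n * \<tau>)))"
      using fourier_expansion_sums(2)[OF f pos] by (intro summable_norm) (simp add: c_def)
    also have "\<dots> \<le> (\<Sum>n. exp (- 2 * pi * (Im \<tau> - y0)) * (norm (c n) * exp (- 2 * pi * real n * y0)))"
    proof (intro suminf_le summable_mult sumD)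
      show "summable (\<lambda>n. norm (c n * exp (2 * pi * \<i> * of_nat n * \<tau>)))"
        using fourier_expansion_sums(2)[OF f pos] by (simp add: c_def)
      fix n
      show "norm (c n * exp (2 * pi * \<i> * of_nat n * \<tau>)) \<le>
        exp (- 2 * pi * (Im \<tau> - y0)) * (norm (c n) * exp (- 2 * pi * real n * y0))"
      proof (cases "n = 0")
        case False
        hence "1 * (Im \<tau> - y0) \<le> real n * (Im \<tau> - y0)"
          using \<tau> by (intro mult_right_mono) auto
        hence "2 * pi * (Im \<tau> - y0) \<le> 2 * pi * (real n * (Im \<tau> - y0))"
          by (intro mult_left_mono) auto
        hence "- 2 * pi * real n * Im \<tau> \<le> - 2 * pi * (Im \<tau> - y0) + - 2 * pi * real n * y0"
          by (simp add: algebra_simps)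
        hence "exp (- 2 * pi * real n * Im \<tau>) \<le> exp (- 2 * pi * (Im \<tau> - y0)) * exp (- 2 * pi * real n * y0)"
          unfolding exp_add[symmetric] exp_le_cancel_iff .
        from mult_left_mono[OF this norm_ge_zero[of "c n"]]
        show ?thesis unfolding norm_mult norm_exp_fourier by (simp only: mult_ac)
      qed (simp add: c_def)
    qed
    also have "\<dots> = exp (- 2 * pi * (Im \<tau> - y0)) * D"
      unfolding D_def by (rule suminf_mult[OF sumD])
    finally show ?thesis .
  qed
  have "((\<lambda>y. y powr r * exp (- 2 * pi * (y - y0))) \<longlongrightarrow> 0) at_top"
    by real_asymp
  hence "\<forall>\<^sub>F y in at_top. y powr r * exp (- 2 * pi * (y - y0)) < 1"
    by (rule order_tendstoD) auto
  then obtain Y where Y: "\<And>y. y \<ge> Y \<Longrightarrow> y powr r * exp (- 2 * pi * (y - y0)) < 1"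
    by (auto simp: eventually_at_top_linorder)
  have "continuous_on {y0..max y0 Y} (\<lambda>y. y powr r * exp (- 2 * pi * (y - y0)))"
    using y0 by (intro continuous_intros) auto
  then obtain B where B: "\<And>y. y \<in> {y0..max y0 Y} \<Longrightarrow> norm (y powr r * exp (- 2 * pi * (y - y0))) \<le> B"
    using compact_continuous_image[of "{y0..max y0 Y}" "\<lambda>y. y powr r * exp (- 2 * pi * (y - y0))"]
    by (force dest: compact_imp_bounded simp: bounded_iff)
  have le: "y powr r * exp (- 2 * pi * (y - y0)) \<le> max 1 B" if "y \<ge> y0" for y
    using Y[of y] B[of y] that by (cases "y \<ge> Y") (force simp: less_imp_le le_max_iff_disj)+
  show ?thesis
  proof (rule that[of "max 1 B * D"])
    show "norm (f \<tau>) * Im \<tau> powr r \<le> max 1 B * D" if "Im \<tau> \<ge> y0" for \<tau>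
    proof -
      have "norm (f \<tau>) * Im \<tau> powr r \<le> (exp (- 2 * pi * (Im \<tau> - y0)) * D) * Im \<tau> powr r"
        by (intro mult_right_mono f_le that) auto
      also have "\<dots> = (Im \<tau> powr r * exp (- 2 * pi * (Im \<tau> - y0))) * D" by (simp only: mult_ac)
      also have "\<dots> \<le> max 1 B * D"
        by (intro mult_right_mono le that D)
      finally show ?thesis .
    qed
  qed (use D in auto)
qed

text \<open>Dirichlet approximation moves every point of the strip to height at least \<open>1/5\<close>,
  which replaces the reduction to a fundamental domain.\<close>

lemma cusp_form_growth:
  assumes cf: "cusp_form k A f" and f: "fourier_expansion a f"
  obtains M where "M \<ge> 0"
    "\<And>\<tau>. 0 < Im \<tau> \<Longrightarrow> Im \<tau> \<le> 1 \<Longrightarrow> norm (f \<tau>) \<le> M * Im \<tau> powr (- k / 2)"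
proof -
  obtain M where M: "M \<ge> 0" "\<And>\<tau>. Im \<tau> \<ge> 1/5 \<Longrightarrow> norm (f \<tau>) * Im \<tau> powr (k / 2) \<le> M"
    using fourier_expansion_bounded_high[OF f, of "1/5" "k/2"] by auto
  have "norm (f \<tau>) \<le> M * Im \<tau> powr (- k / 2)" if \<tau>: "0 < Im \<tau>" "Im \<tau> \<le> 1" for \<tau>
  proof -
    define y where "y = Im \<tau>"
    have y: "0 < y" "y \<le> 1" using \<tau> by (auto simp: y_def)
    \<comment> \<open>With \<open>N\<close> of order \<open>1 / sqrt y\<close>, both parts of
      \<open>c * \<tau> - h\<close> are of order \<open>sqrt y\<close>: the real part is below
      \<open>1 / N \<le> sqrt y\<close>, the imaginary part at most
      \<open>N * y \<le> 2 * sqrt y\<close>. Hence its squared modulus is at most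
      \<open>5 * y\<close>.\<close>
    define N where "N = nat \<lceil>1 / sqrt y\<rceil>"
    have N: "real N \<ge> 1 / sqrt y" "real N \<le> 1 / sqrt y + 1" "N > 0"
      using y unfolding N_def by (linarith | simp)+
    have "1 \<le> 1 / sqrt y" using y by simp
    hence N2: "real N \<le> 2 / sqrt y" using N(2) by simp
    obtain h c where hc: "coprime h c" "0 < c" "c \<le> int N" "\<bar>of_int c * Re \<tau> - of_int h\<bar> < 1 / N"
      using Dirichlet_approx_coprime[OF N(3)] by blast
    have "coprime c (- h)" using hc(1) by (simp add: coprime_commute)
    then obtain \<gamma> :: "int ^ 2 ^ 2" where \<gamma>: "\<gamma> \<in> SL2Z" "\<gamma> $ 2 $ 1 = c" "\<gamma> $ 2 $ 2 = - h"
      by (rule SL2Z_bottom_row)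
    define w where "w = of_int (\<gamma> $ 2 $ 1) * \<tau> + of_int (\<gamma> $ 2 $ 2)"
    have "Im w > 0" using hc \<tau> by (simp add: w_def \<gamma>)
    hence "w \<noteq> 0" by auto
    have "(norm w)\<^sup>2 = (of_int c * Re \<tau> - of_int h)\<^sup>2 + (of_int c * y)\<^sup>2"
      by (simp add: w_def \<gamma> cmod_power2 y_def)
    also have "\<dots> \<le> y + 4 * y"
    proof (intro add_mono)
      have "1 / real N \<le> sqrt y" using N(1,3) y by (simp add: field_simps)
      hence "\<bar>of_int c * Re \<tau> - of_int h\<bar> \<le> sqrt y" using hc(4) by simp
      hence "(of_int c * Re \<tau> - of_int h)\<^sup>2 \<le> (sqrt y)\<^sup>2"
        by (rule abs_le_square_iff[THEN iffD1, OF order.trans]) (use y in auto)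
      thus "(of_int c * Re \<tau> - of_int h)\<^sup>2 \<le> y" using y by simp
      have "of_int c \<le> real N" using hc(3) by linarith
      hence "of_int c * y \<le> 2 / sqrt y * y" using N2 y by (intro mult_right_mono) auto
      also have "\<dots> = 2 * sqrt y" using y by (simp add: field_simps)
      finally have "(of_int c * y)\<^sup>2 \<le> (2 * sqrt y)\<^sup>2"
        using hc(2) y by (intro power_mono) auto
      thus "(of_int c * y)\<^sup>2 \<le> 4 * y" using y by (simp add: power_mult_distrib)
    qed
    finally have w5: "(norm w)\<^sup>2 \<le> 5 * y" by simp
    define Y where "Y = Im (moebius \<gamma> \<tau>)"
    have Y: "Y = y / (norm w)\<^sup>2" using Im_moebius[OF \<gamma>(1), of \<tau>] by (simp add: Y_def w_def y_def)
    have "Y \<ge> 1 / 5" using w5 \<open>w \<noteq> 0\<close> y unfolding Y by (simp add: field_simps)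
    have "f (moebius \<gamma> \<tau>) = A \<gamma> * (- \<i> * w) powr of_real k * f \<tau>" "norm (A \<gamma>) = 1"
      using cf \<gamma> hc(2) \<tau> unfolding cusp_form_def w_def by (auto simp: upper_half_plane_def)
    hence nf: "norm (f (moebius \<gamma> \<tau>)) = norm w powr k * norm (f \<tau>)"
      by (simp add: norm_mult norm_powr_real_powr')
    \<comment> \<open>The product of \<open>norm (f \<tau>)\<close> and
      \<open>Im \<tau> powr (k / 2)\<close> is invariant under \<gamma>, so the bound at large
      height carries over to \<tau>.\<close>
    have "Y powr (k / 2) = y powr (k / 2) / norm w powr k"
      using y \<open>w \<noteq> 0\<close> unfolding Y
      by (simp add: powr_divide powr_powr flip: powr_numeral)
    hence "norm (f \<tau>) * y powr (k / 2) = norm (f (moebius \<gamma> \<tau>)) * Y powr (k / 2)"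
      using \<open>w \<noteq> 0\<close> by (simp add: nf)
    also have "\<dots> \<le> M" using M(2)[of "moebius \<gamma> \<tau>"] \<open>Y \<ge> 1 / 5\<close> by (simp add: Y_def)
    finally have "norm (f \<tau>) * y powr (k / 2) \<le> M" .
    thus ?thesis using y by (simp add: powr_minus field_simps flip: y_def)
  qed
  with M(1) show ?thesis by (rule that)
qed

section \<open>Mean squares and summability of the coefficients\<close>

text \<open>A geometric sum whose ratio is an \<open>L\<close>-th root of unity. The ratio is
  \<open>1\<close> only if \<open>L\<close> divides \<open>n - m\<close>, which for indices below
  \<open>L\<close> forces \<open>n = m\<close>.\<close>

lemma sum_roots_of_unity:
  fixes n m L :: nat
  assumes "n < L" "m < L"
  shows "(\<Sum>j<L. cis (2 * pi * real n * real j / real L) * cnj (cis (2 * pi * real m * real j / real L)))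
          = (if n = m then of_nat L else 0)"
proof -
  define z where "z = cis (2 * pi * (real n - real m) / real L)"
  have L: "L > 0" using assms by auto
  have "cis (2 * pi * real n * real j / real L) * cnj (cis (2 * pi * real m * real j / real L)) = z ^ j" for j
  proof -
    have "2 * pi * real n * real j / real L - 2 * pi * real m * real j / real L =
        real j * (2 * pi * (real n - real m) / real L)"
      using L by (simp add: field_simps)
    moreover have "cis x * cnj (cis y) = cis (x - y)" for x y
      by (simp add: cis_cnj cis_mult)
    ultimately show ?thesis by (simp only: z_def Complex.DeMoivre)
  qed
  hence "(\<Sum>j<L. cis (2 * pi * real n * real j / real L) * cnj (cis (2 * pi * real m * real j / real L)))
     = (if z = 1 then of_nat L else (1 - z ^ L) / (1 - z))"
    by (simp add: sum_gp_strict)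
  also have "z ^ L = 1"
    using L cis_multiple_2pi[of "real n - real m"] by (simp add: z_def Complex.DeMoivre)
  also have "z = 1 \<longleftrightarrow> n = m"
  proof
    assume "z = 1"
    then obtain i :: int where "2 * pi * (real n - real m) / real L = of_int (2 * i) * pi"
      by (auto simp: z_def cis_conv_exp exp_eq_1)
    hence "2 * pi * (real n - real m) = 2 * pi * (of_int i * real L)"
      using L by (simp add: field_simps)
    hence "real n - real m = of_int i * real L" by simp
    hence "real_of_int (int n - int m) = real_of_int (i * int L)" by simp
    hence "int n - int m = i * int L" by (simp only: of_int_eq_iff)
    moreover have "\<bar>int n - int m\<bar> < int L" using assms by auto
    ultimately have "\<bar>i\<bar> * int L < 1 * int L" by (simp add: abs_mult)
    hence "\<bar>i\<bar> < 1" by (rule mult_right_less_imp_less) simp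
    hence "i = 0" by simp
    thus "n = m" using \<open>int n - int m = i * int L\<close> by simp
  qed (simp add: z_def)
  finally show ?thesis by simp
qed

text \<open>Averaging over \<open>L\<close> equally spaced points replaces integration over a
  period; expanding the squares leaves only the diagonal.\<close>

lemma discrete_parseval:
  fixes c :: "nat \<Rightarrow> complex"
  shows "(\<Sum>j<L. (norm (\<Sum>n<L. c n * cis (2 * pi * real n * real j / real L)))\<^sup>2) =
          real L * (\<Sum>n<L. (norm (c n))\<^sup>2)"
proof -
  define e where "e n j = cis (2 * pi * real n * real j / real L)" for n j :: nat
  have "of_real (\<Sum>j<L. (norm (\<Sum>n<L. c n * e n j))\<^sup>2) =
     (\<Sum>j<L. (\<Sum>n<L. c n * e n j) * cnj (\<Sum>m<L. c m * e m j))"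
    by (simp only: of_real_sum complex_norm_square)
  also have "\<dots> = (\<Sum>j<L. \<Sum>n<L. \<Sum>m<L. c n * cnj (c m) * (e n j * cnj (e m j)))"
    by (simp add: sum_product mult_ac)
  also have "\<dots> = (\<Sum>n<L. \<Sum>j<L. \<Sum>m<L. c n * cnj (c m) * (e n j * cnj (e m j)))"
    by (rule sum.swap)
  also have "\<dots> = (\<Sum>n<L. \<Sum>m<L. \<Sum>j<L. c n * cnj (c m) * (e n j * cnj (e m j)))"
    by (intro sum.cong refl sum.swap)
  also have "\<dots> = (\<Sum>n<L. \<Sum>m<L. c n * cnj (c m) * (if n = m then of_nat L else 0))"
    by (simp add: sum_roots_of_unity e_def flip: sum_distrib_left)
  also have "\<dots> = (\<Sum>n<L. of_nat L * (c n * cnj (c n)))"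
    by (simp add: if_distrib sum.delta mult_ac cong: if_cong)
  also have "\<dots> = of_real (real L * (\<Sum>n<L. (norm (c n))\<^sup>2))"
    by (simp only: of_real_mult of_real_sum complex_norm_square sum_distrib_left of_real_of_nat_eq)
  finally show ?thesis unfolding e_def of_real_eq_iff .
qed

text \<open>Parseval at height \<open>y\<close> bounds the sum of
  \<open>\<bar>a n\<bar>^2 * exp (- 4 * pi * n * y)\<close> by the square of
  \<open>M * y powr (- k / 2)\<close>. At \<open>y = 1 / N\<close> the weights for
  \<open>n \<le> N\<close> are at least \<open>exp (- 4 * pi)\<close>.\<close>

lemma fourier_coefficients_square_sum:
  assumes cf: "cusp_form k A f" and f: "fourier_expansion a f"
  obtains C where "C \<ge> 0"
    "\<And>N. N \<ge> 1 \<Longrightarrow> (\<Sum>n\<le>N. (norm (if n = 0 then 0 else a n))\<^sup>2) \<le> C * real N powr k"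
proof -
  define c where "c n = (if n = 0 then 0 else a n)" for n
  obtain M where M: "M \<ge> 0" "\<And>\<tau>. 0 < Im \<tau> \<Longrightarrow> Im \<tau> \<le> 1 \<Longrightarrow> norm (f \<tau>) \<le> M * Im \<tau> powr (- k / 2)"
    using cusp_form_growth[OF cf f] by blast
  have gutzmer: "(\<Sum>n\<le>N. (norm (c n) * exp (- 2 * pi * real n * y))\<^sup>2) \<le> (M * y powr (- k / 2))\<^sup>2"
    if y: "0 < y" "y \<le> 1" for N y
  proof -
    define g where "g n = norm (c n) * exp (- 2 * pi * real n * y)" for n
    have sum_g: "summable g"
      using fourier_expansion_sums(2)[OF f, of "\<i> * of_real y"] y
      by (simp add: c_def norm_mult g_def[abs_def])
    have le: "(\<Sum>n\<le>N. (g n)\<^sup>2) \<le> (M * y powr (- k / 2) + (suminf g - (\<Sum>n<L. g n)))\<^sup>2" if L: "L > N" for L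
    proof -
      have "L > 0" using L by simp
      \<comment> \<open>The bound for the series cut off at \<open>L\<close>: the growth bound for
        \<open>f\<close> plus the tail of the norms. The tail vanishes as \<open>L\<close>
        grows.\<close>
      define B where "B = M * y powr (- k / 2) + (suminf g - (\<Sum>n<L. g n))"
      have bound: "norm (\<Sum>n<L. (c n * exp (- 2 * pi * real n * y)) * cis (2 * pi * real n * real j / real L)) \<le> B" for j
      proof -
        \<comment> \<open>The \<open>j\<close>-th of \<open>L\<close> sample points on the
          horizontal segment at height \<open>y\<close>.\<close>
        define \<tau> where "\<tau> = of_real (real j / real L) + \<i> * of_real y"
        define t where "t n = c n * exp (2 * pi * \<i> * of_nat n * \<tau>)" for n
        have Im_\<tau>: "Im \<tau> = y" by (simp add: \<tau>_def)
        have t_sums: "t sums f \<tau>" and t_summable: "summable (\<lambda>n. norm (t n))"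
          using fourier_expansion_sums[OF f, of \<tau>] y by (auto simp: t_def[abs_def] c_def Im_\<tau>)
        have norm_t: "norm (t n) = g n" for n
          by (simp add: t_def norm_mult Im_\<tau> g_def)
        have t_eq: "t n = (c n * exp (- 2 * pi * real n * y)) * cis (2 * pi * real n * real j / real L)" for n
          by (simp add: t_def \<tau>_def cis_conv_exp algebra_simps flip: exp_add exp_of_real)
        have "(\<Sum>n<L. t n) = f \<tau> - (\<Sum>n. t (n + L))"
          using suminf_minus_initial_segment[OF sums_summable[OF t_sums], of L] t_sums by (simp add: sums_iff)
        also have "norm \<dots> \<le> norm (f \<tau>) + norm (\<Sum>n. t (n + L))"
          by (rule norm_triangle_ineq4)
        also have "norm (\<Sum>n. t (n + L)) \<le> (\<Sum>n. norm (t (n + L)))"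
          using t_summable by (intro summable_norm) (subst summable_iff_shift)
        also have "\<dots> = suminf g - (\<Sum>n<L. g n)"
          unfolding norm_t by (rule suminf_minus_initial_segment[OF sum_g])
        also have "norm (f \<tau>) \<le> M * y powr (- k / 2)"
          using M(2)[of \<tau>] y by (simp add: Im_\<tau>)
        finally show ?thesis by (simp add: t_eq B_def)
      qed
      have "real L * (\<Sum>n<L. (g n)\<^sup>2) =
        (\<Sum>j<L. (norm (\<Sum>n<L. (c n * exp (- 2 * pi * real n * y)) * cis (2 * pi * real n * real j / real L)))\<^sup>2)"
        by (subst discrete_parseval) (simp add: g_def norm_mult)
      also have "\<dots> \<le> (\<Sum>j<L. B\<^sup>2)"
        by (intro sum_mono power_mono bound) auto
      also have "\<dots> = real L * B\<^sup>2" by simp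
      finally have "(\<Sum>n<L. (g n)\<^sup>2) \<le> B\<^sup>2" using \<open>L > 0\<close> by simp
      moreover have "(\<Sum>n\<le>N. (g n)\<^sup>2) \<le> (\<Sum>n<L. (g n)\<^sup>2)"
        using L by (intro sum_mono2) auto
      ultimately show ?thesis by (simp add: B_def)
    qed
    have "(\<lambda>L. (M * y powr (- k / 2) + (suminf g - (\<Sum>n<L. g n)))\<^sup>2)
        \<longlonglongrightarrow> (M * y powr (- k / 2) + (suminf g - suminf g))\<^sup>2"
      by (intro tendsto_intros summable_LIMSEQ sum_g)
    hence "(\<Sum>n\<le>N. (g n)\<^sup>2) \<le> (M * y powr (- k / 2) + (suminf g - suminf g))\<^sup>2"
      by (rule LIMSEQ_le_const) (use le in \<open>auto intro!: exI[of _ "Suc N"]\<close>)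
    thus ?thesis by (simp add: g_def)
  qed
  have "(\<Sum>n\<le>N. (norm (c n))\<^sup>2) \<le> exp (4 * pi) * M\<^sup>2 * real N powr k" if N: "N \<ge> 1" for N
  proof -
    have "exp (- 4 * pi) * (\<Sum>n\<le>N. (norm (c n))\<^sup>2) \<le> (\<Sum>n\<le>N. (norm (c n) * exp (- 2 * pi * real n * (1 / real N)))\<^sup>2)"
      unfolding sum_distrib_left
    proof (intro sum_mono)
      fix n assume n: "n \<in> {..N}"
      have "exp (- 4 * pi) \<le> exp (2 * (- 2 * pi * real n * (1 / real N)))"
        using n N by (simp add: field_simps)
      also have "\<dots> = (exp (- 2 * pi * real n * (1 / real N)))\<^sup>2"
        by (rule exp_double)
      finally show "exp (- 4 * pi) * (norm (c n))\<^sup>2 \<le> (norm (c n) * exp (- 2 * pi * real n * (1 / real N)))\<^sup>2"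
        by (simp add: power_mult_distrib mult.commute mult_left_mono)
    qed
    also have "\<dots> \<le> (M * (1 / real N) powr (- k / 2))\<^sup>2"
      using N by (intro gutzmer) auto
    also have "\<dots> = M\<^sup>2 * real N powr k"
    proof -
      have "((1 / real N) powr (- k / 2))\<^sup>2 = real N powr k"
        using N by (simp add: powr_divide powr_minus power2_eq_square flip: powr_add)
      thus ?thesis by (simp add: power_mult_distrib)
    qed
    finally show ?thesis by (simp add: exp_minus field_simps)
  qed
  with that[of "exp (4 * pi) * M\<^sup>2"] show ?thesis by (simp add: c_def)
qed

text \<open>Cauchy-Schwarz on the dyadic block starting at \<open>x = 2^j\<close> bounds its
  contribution by a constant times \<open>x powr (- k / 2)\<close>, which is geometric in
  \<open>j\<close>. A pointwise bound of order \<open>n powr (k / 2)\<close> would give convergence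
  only for \<open>k > 1\<close>; the mean square covers all \<open>k > 0\<close>.\<close>

lemma summable_of_square_sum_bound:
  fixes s :: "nat \<Rightarrow> real"
  assumes s: "\<And>n. s n \<ge> 0" "s 0 = 0" and k: "k > 0" and C: "C \<ge> 0"
    and le: "\<And>N. N \<ge> 1 \<Longrightarrow> (\<Sum>n\<le>N. (s n)\<^sup>2) \<le> C * real N powr k"
  shows "summable (\<lambda>n. s n * real n powr - (k + 1/2))"
proof (rule summableI_nonneg_bounded)
  define q where "q = 2 powr (- k / 2)"
  define D where "D = sqrt (C * 2 powr k)"
  have q: "0 < q" "q < 1" using k by (auto simp: q_def powr_less_one)
  have block: "(\<Sum>n\<in>{2^j..<2^Suc j}. s n * real n powr - (k + 1/2)) \<le> D * q ^ j" for j
  proof -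
    define x :: real where "x = 2 ^ j"
    have x: "x > 0" by (simp add: x_def)
    have "(\<Sum>n\<in>{2^j..<2^Suc j}. s n * real n powr - (k + 1/2)) \<le> (\<Sum>n\<in>{2^j..<2^Suc j}. s n * x powr - (k + 1/2))"
      using k s x by (intro sum_mono mult_left_mono powr_mono2') (auto simp: x_def simp flip: of_nat_le_iff)
    also have "\<dots> = (\<Sum>n\<in>{2^j..<2^Suc j}. s n) * x powr - (k + 1/2)"
      by (simp add: sum_distrib_right)
    also have "(\<Sum>n\<in>{2^j..<2^Suc j}. s n) \<le> sqrt (x * (C * (2 * x) powr k))"
    proof (rule real_le_rsqrt)
      have "(\<Sum>n\<in>{2^j..<2^Suc j}. s n)\<^sup>2 \<le> (\<Sum>n\<in>{2^j..<2^Suc j}. (s n)\<^sup>2) * real (card {2^j..<2^Suc j :: nat})"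
        by (rule sum_squared_le_sum_of_squares)
      also have "real (card {2^j..<2^Suc j :: nat}) = x" by (simp add: x_def)
      also have "(\<Sum>n\<in>{2^j..<2^Suc j}. (s n)\<^sup>2) \<le> (\<Sum>n\<le>2^Suc j. (s n)\<^sup>2)"
        by (intro sum_mono2) auto
      also have "\<dots> \<le> C * real (2 ^ Suc j) powr k" by (rule le) simp
      also have "real (2 ^ Suc j) = 2 * x" by (simp add: x_def)
      finally show "(\<Sum>n\<in>{2^j..<2^Suc j}. s n)\<^sup>2 \<le> x * (C * (2 * x) powr k)"
        using x by (simp add: mult.commute mult_left_mono)
    qed
    also have "sqrt (x * (C * (2 * x) powr k)) * x powr - (k + 1/2) = D * x powr (- k / 2)"
    proof -
      have "x * (C * (2 * x) powr k) = (C * 2 powr k) * x powr (1 + k)"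
        using x by (simp add: powr_mult powr_add)
      moreover have "sqrt (x powr (1 + k)) = x powr ((1 + k) / 2)"
        by (subst powr_half_sqrt[symmetric]) (auto simp: powr_powr)
      ultimately have "sqrt (x * (C * (2 * x) powr k)) = D * x powr ((1 + k) / 2)"
        by (simp only: D_def real_sqrt_mult)
      thus ?thesis by (simp add: field_simps flip: powr_add)
    qed
    also have "x powr (- k / 2) = q ^ j"
    proof -
      have "x powr (- k / 2) = (2 powr real j) powr (- k / 2)" by (simp add: x_def powr_realpow)
      also have "\<dots> = q powr real j" by (simp add: q_def powr_powr mult.commute)
      also have "\<dots> = q ^ j" using q by (simp add: powr_realpow)
      finally show ?thesis .
    qed
    finally show ?thesis using x by (simp add: mult_right_mono)
  qed
  have dyadic: "(\<Sum>n<2^J. s n * real n powr - (k + 1/2)) \<le> D * (\<Sum>j<J. q ^ j)" for J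
  proof (induction J)
    case 0
    have "{..<2 ^ 0 :: nat} = {0}" by auto
    thus ?case using s(2) by simp
  next
    case (Suc J)
    have "(\<Sum>n<2^Suc J. s n * real n powr - (k + 1/2)) =
       (\<Sum>n<2^J. s n * real n powr - (k + 1/2)) + (\<Sum>n\<in>{2^J..<2^Suc J}. s n * real n powr - (k + 1/2))"
      unfolding lessThan_atLeast0
      by (intro sum.atLeastLessThan_concat[symmetric]) auto
    also have "\<dots> \<le> D * (\<Sum>j<J. q ^ j) + D * q ^ J"
      by (intro add_mono Suc.IH block)
    finally show ?case by (simp add: distrib_left)
  qed
  fix N
  show "s N * real N powr - (k + 1/2) \<ge> 0" using s by simp
  have "(\<Sum>n<N. s n * real n powr - (k + 1/2)) \<le> (\<Sum>n<2^N. s n * real n powr - (k + 1/2))"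
    using s less_exp[of N] by (intro sum_mono2) auto
  also have "\<dots> \<le> D * (\<Sum>j<N. q ^ j)" by (rule dyadic)
  also have "\<dots> \<le> D * (1 / (1 - q))"
    using q C geometric_sum_less[of q "{..<N}"] by (intro mult_left_mono) (auto simp: D_def)
  finally show "(\<Sum>n<N. s n * real n powr - (k + 1/2)) \<le> D * (1 / (1 - q))" .
qed

section \<open>Oscillation of the partial sums\<close>

text \<open>On the line above \<open>- d / c\<close>, with
  \<open>\<tau> = (- d + \<i> * u) / c\<close>, the factor \<open>- \<i> * (c * \<tau> + d)\<close>
  is the positive real \<open>u\<close>. The power is then real, and the image of the line lies
  above \<open>a / c\<close>.\<close>

lemma cusp_form_vertical_line:
  fixes \<gamma> :: "int ^ 2 ^ 2" and a c d :: int and u :: real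
  assumes "cusp_form k A f" "\<gamma> \<in> SL2Z" "c > 0" "u > 0"
    and entries: "\<gamma> $ 1 $ 1 = a" "\<gamma> $ 2 $ 1 = c" "\<gamma> $ 2 $ 2 = d"
  shows "f (of_real (of_int a / of_int c) + \<i> * of_real (1 / (of_int c * u))) =
      A \<gamma> * of_real (u powr k) * f (of_real (- of_int d / of_int c) + \<i> * of_real (u / of_int c))"
proof -
  define b where "b = \<gamma> $ 1 $ 2"
  define a' b' c' d' :: complex where "a' = of_int a" "b' = of_int b" "c' = of_int c" "d' = of_int d"
  note defs = this
  have "a * d - b * c = 1"
    using assms(2) by (simp add: SL2Z_def det_2 b_def entries)
  hence "complex_of_int (a * d - b * c) = 1" by simp
  hence det: "a' * d' - b' * c' = 1" by (simp add: defs)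
  have c': "c' \<noteq> 0" using assms(3) by (simp add: defs)
  define \<tau> where "\<tau> = - d' / c' + \<i> * of_real u / c'"
  have \<tau>_eq: "\<tau> = of_real (- of_int d / of_int c) + \<i> * of_real (u / of_int c)"
    by (simp add: \<tau>_def defs)
  have "Im \<tau> = u / of_int c" unfolding \<tau>_eq by (simp only: Im_complex_of_real plus_complex.sel) simp
  hence "\<tau> \<in> upper_half_plane" using assms(3,4) by (simp add: upper_half_plane_def)
  hence "f (moebius \<gamma> \<tau>) = A \<gamma> * (- \<i> * (c' * \<tau> + d')) powr of_real k * f \<tau>"
    using assms(1-3) by (simp add: cusp_form_def defs entries)
  moreover have cd: "c' * \<tau> + d' = \<i> * of_real u"
    using c' by (simp add: \<tau>_def field_simps)
  moreover have "(of_real u :: complex) powr of_real k = of_real (u powr k)"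
    using assms(4) by (simp add: powr_of_real)
  moreover have "moebius \<gamma> \<tau> = of_real (of_int a / of_int c) + \<i> * of_real (1 / (of_int c * u))"
  proof -
    have "moebius \<gamma> \<tau> = (a' * \<tau> + b') / (\<i> * of_real u)"
      using cd by (simp add: moebius_def defs entries b_def)
    also have "a' * \<tau> + b' = (\<i> * a' * of_real u - (a' * d' - b' * c')) / c'"
      using c' by (simp add: \<tau>_def field_simps)
    also have "\<dots> / (\<i> * of_real u) = a' / c' + \<i> / (c' * of_real u)"
      using c' assms(4) by (simp add: det field_simps)
    also have "\<dots> = of_real (of_int a / of_int c) + \<i> * of_real (1 / (of_int c * u))"
      by (simp add: defs)
    finally show ?thesis .
  qed
  ultimately show ?thesis
    by (simp add: \<tau>_eq)
qed

text \<open>Exceeding a fixed positive multiple of \<open>h\<close> at arbitrarily large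
  \<open>x\<close> keeps the upper limit of the quotient away from \<open>0\<close>; the lower limit
  is treated through \<open>- g\<close>.\<close>

lemma Omega_pm_frequentlyI:
  assumes "\<epsilon>\<^sub>1 > 0" "\<exists>\<^sub>F x in at_top. g x > \<epsilon>\<^sub>1 * h x"
    and "\<epsilon>\<^sub>2 > 0" "\<exists>\<^sub>F x in at_top. - g x > \<epsilon>\<^sub>2 * h x"
    and h: "\<forall>\<^sub>F x in at_top. h x > 0"
  shows "Omega_pm g h"
  unfolding Omega_pm_def
proof
  show "Limsup at_top (\<lambda>x. ereal (g x / h x)) > 0"
  proof (rule ccontr)
    assume "\<not> Limsup at_top (\<lambda>x. ereal (g x / h x)) > 0"
    hence "Limsup at_top (\<lambda>x. ereal (g x / h x)) < ereal \<epsilon>\<^sub>1"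
      using assms(1) by (simp add: not_less le_less_trans)
    hence "\<forall>\<^sub>F x in at_top. ereal (g x / h x) < ereal \<epsilon>\<^sub>1" by (rule Limsup_lessD)
    with h have "\<forall>\<^sub>F x in at_top. \<not> g x > \<epsilon>\<^sub>1 * h x"
      by eventually_elim (simp add: field_simps)
    with assms(2) show False by (simp add: frequently_def)
  qed
  show "Liminf at_top (\<lambda>x. ereal (g x / h x)) < 0"
  proof (rule ccontr)
    assume "\<not> Liminf at_top (\<lambda>x. ereal (g x / h x)) < 0"
    hence "0 \<le> Liminf at_top (\<lambda>x. ereal (g x / h x))" by simp
    moreover have "ereal (- \<epsilon>\<^sub>2) < 0" using assms(3) by simp
    ultimately have "ereal (- \<epsilon>\<^sub>2) < Liminf at_top (\<lambda>x. ereal (g x / h x))"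
      by (rule less_le_trans[rotated])
    hence "\<forall>\<^sub>F x in at_top. ereal (- \<epsilon>\<^sub>2) < ereal (g x / h x)" by (rule less_LiminfD)
    with h have "\<forall>\<^sub>F x in at_top. \<not> - g x > \<epsilon>\<^sub>2 * h x"
      by eventually_elim (simp add: field_simps)
    with assms(4) show False by (simp add: frequently_def)
  qed
qed

theorem theorem1p2:
  fixes k :: real
    and f :: "complex \<Rightarrow> complex"
    and a :: "nat \<Rightarrow> complex"
    and A :: "int ^ 2 ^ 2 \<Rightarrow> complex"
    and \<gamma> :: "int ^ 2 ^ 2"
  assumes "k > 0"
    and "cusp_form k A f"
    and "fourier_expansion a f"
    and "\<exists>n\<ge>1. a n \<noteq> 0"
    and "\<gamma> \<in> SL2Z"
    and "\<gamma> $ 2 $ 1 > 0"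
    and "\<exists>n\<ge>1. Re (A \<gamma> * a n *
           exp (- 2 * pi * \<i> * of_nat n * of_int (\<gamma> $ 2 $ 2) / of_int (\<gamma> $ 2 $ 1))) \<noteq> 0"
  shows "Omega_pm (\<lambda>x. Re (twisted_sum a x (real_of_int (\<gamma> $ 1 $ 1) / real_of_int (\<gamma> $ 2 $ 1))))
                  (\<lambda>x. x powr (k / 2 - 1 / 4))"
proof -
  define \<alpha> where "\<alpha> = real_of_int (\<gamma> $ 1 $ 1) / real_of_int (\<gamma> $ 2 $ 1)"
  define \<beta> where "\<beta> = - real_of_int (\<gamma> $ 2 $ 2) / real_of_int (\<gamma> $ 2 $ 1)"
  define c where "c = real_of_int (\<gamma> $ 2 $ 1)"
  \<comment> \<open>The Fourier expansion says nothing about \<open>a 0\<close>, so it is replaced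
    by \<open>0\<close>.\<close>
  define a' where "a' n = (if n = 0 then 0 else a n)" for n
  define e where "e x n = exp (2 * pi * \<i> * of_nat n * of_real x)" for x :: real and n :: nat
  define b where "b n = Re (a' n * e \<alpha> n)" for n
  define B where "B n = Re (A \<gamma> * (a' n * e \<beta> n))" for n
  define p where "p = k + 1 / 2"
  have c: "c > 0" using assms by (simp add: c_def)
  have norm_A: "norm (A \<gamma>) = 1" using assms by (simp add: cusp_form_def)
  have norm_e: "norm (e x n) = 1" for x n by (simp add: e_def)
  have summable_a: "summable (\<lambda>n. norm (a' n) * real n powr - p)"
  proof -
    obtain C where "C \<ge> 0" "\<And>N. N \<ge> 1 \<Longrightarrow> (\<Sum>n\<le>N. (norm (a' n))\<^sup>2) \<le> C * real N powr k"
      using fourier_coefficients_square_sum[OF assms(2,3)] unfolding a'_def by blast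
    thus ?thesis unfolding p_def
      by (intro summable_of_square_sum_bound) (use assms(1) in \<open>auto simp: a'_def\<close>)
  qed
  have summable_real: "summable (\<lambda>n. \<bar>s n\<bar> * real n powr - p)" if "\<And>n. \<bar>s n\<bar> \<le> norm (a' n)" for s :: "nat \<Rightarrow> real"
    by (rule summable_comparison_test[OF _ summable_a])
       (use that in \<open>auto simp: abs_mult intro!: mult_right_mono\<close>)
  have expand: "(\<lambda>n. (a' n * e x n) * of_real (exp (- 2 * pi * y * real n))) sums f (of_real x + \<i> * of_real y)"
    if "y > 0" for x y
  proof -
    have "a' n * exp (2 * pi * \<i> * of_nat n * (of_real x + \<i> * of_real y)) =
       (a' n * e x n) * of_real (exp (- 2 * pi * y * real n))" for n
      by (simp add: e_def algebra_simps flip: exp_of_real exp_add)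
    moreover have "(\<lambda>n. a' n * exp (2 * pi * \<i> * of_nat n * (of_real x + \<i> * of_real y)))
        sums f (of_real x + \<i> * of_real y)"
      unfolding a'_def using that by (intro fourier_expansion_sums(1) assms) auto
    ultimately show ?thesis by (simp only:)
  qed
  interpret theta_transformation b B k "(2 * pi / c)\<^sup>2" "(2 * pi / c) powr k" p
  proof
    show "summable (\<lambda>n. \<bar>b n\<bar> * real n powr - p)"
    proof (rule summable_real)
      show "\<bar>b n\<bar> \<le> norm (a' n)" for n
        using abs_Re_le_cmod[of "a' n * e \<alpha> n"] by (simp only: b_def norm_mult norm_e mult_1_right)
    qed
    show "summable (\<lambda>n. \<bar>B n\<bar> * real n powr - p)"
    proof (rule summable_real)
      show "\<bar>B n\<bar> \<le> norm (a' n)" for n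
        using abs_Re_le_cmod[of "A \<gamma> * (a' n * e \<beta> n)"]
        by (simp only: B_def norm_mult norm_e norm_A mult_1_right mult_1_left)
    qed
    fix v :: real assume v: "v > 0"
    \<comment> \<open>This scaling turns the exponents \<open>2 * pi * n / (c * u)\<close> and
      \<open>2 * pi * n * u / c\<close> into \<open>n / v\<close> and
      \<open>(2 * pi / c)^2 * n * v\<close>, the form required by the locale.\<close>
    define u where "u = 2 * pi / c * v"
    have u: "u > 0" using v c by (simp add: u_def)
    have "(\<lambda>n. Re ((a' n * e \<alpha> n) * of_real (exp (- 2 * pi * (1 / (c * u)) * real n))))
        sums Re (f (of_real \<alpha> + \<i> * of_real (1 / (c * u))))"
      using u c by (intro sums_Re expand) auto
    moreover have "- 2 * pi * (1 / (c * u)) * real n = - real n / v" for n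
      using v c by (simp add: u_def field_simps)
    ultimately have 1: "(\<lambda>n. b n * exp (- real n / v)) sums Re (f (of_real \<alpha> + \<i> * of_real (1 / (c * u))))"
      by (simp add: b_def)
    have "(\<lambda>n. Re (A \<gamma> * ((a' n * e \<beta> n) * of_real (exp (- 2 * pi * (u / c) * real n)))))
        sums Re (A \<gamma> * f (of_real \<beta> + \<i> * of_real (u / c)))"
      using u c by (intro sums_Re sums_mult expand) auto
    moreover have "Re (A \<gamma> * ((a' n * e \<beta> n) * of_real (exp (- 2 * pi * (u / c) * real n)))) =
        B n * exp (- (2 * pi / c)\<^sup>2 * real n * v)" for n
    proof -
      have "- 2 * pi * (u / c) * real n = - (2 * pi / c)\<^sup>2 * real n * v"
        by (simp add: u_def power2_eq_square)
      moreover have "Re (w * (z * of_real r)) = Re (w * z) * r" for w z r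
        by (simp add: algebra_simps)
      ultimately show ?thesis by (simp only: B_def)
    qed
    ultimately have 2: "(\<lambda>n. B n * exp (- (2 * pi / c)\<^sup>2 * real n * v)) sums Re (A \<gamma> * f (of_real \<beta> + \<i> * of_real (u / c)))"
      by simp
    have "f (of_real \<alpha> + \<i> * of_real (1 / (c * u))) = A \<gamma> * of_real (u powr k) * f (of_real \<beta> + \<i> * of_real (u / c))"
      using cusp_form_vertical_line[OF assms(2,5,6) u refl refl refl] unfolding \<alpha>_def \<beta>_def c_def .
    hence "f (of_real \<alpha> + \<i> * of_real (1 / (c * u))) = of_real (u powr k) * (A \<gamma> * f (of_real \<beta> + \<i> * of_real (u / c)))"
      by simp
    \<comment> \<open>Real parts may be taken because \<open>u powr k\<close> is real;
      \<open>A \<gamma>\<close> stays inside, which is why it appears in \<open>B\<close>.\<close>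
    hence "Re (f (of_real \<alpha> + \<i> * of_real (1 / (c * u)))) = u powr k * Re (A \<gamma> * f (of_real \<beta> + \<i> * of_real (u / c)))"
      by (simp only: Re_of_real_mult)
    moreover have "u powr k = (2 * pi / c) powr k * v powr k"
      unfolding u_def by (rule powr_mult)
    ultimately show "(\<Sum>n. b n * exp (- real n / v)) =
        (2 * pi / c) powr k * v powr k * (\<Sum>n. B n * exp (- (2 * pi / c)\<^sup>2 * real n * v))"
      using 1 2 by (simp only: sums_iff)
  qed (use assms(1) c in \<open>auto simp: p_def b_def B_def a'_def\<close>)
  obtain m where m: "m \<ge> 1" "B m \<noteq> 0"
  proof -
    obtain n where n: "n \<ge> 1" "Re (A \<gamma> * a n *
           exp (- 2 * pi * \<i> * of_nat n * of_int (\<gamma> $ 2 $ 2) / of_int (\<gamma> $ 2 $ 1))) \<noteq> 0"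
      using assms(7) by blast
    have "e \<beta> n = exp (- 2 * pi * \<i> * of_nat n * of_int (\<gamma> $ 2 $ 2) / of_int (\<gamma> $ 2 $ 1))"
      by (simp add: e_def \<beta>_def)
    hence "B n \<noteq> 0" using n by (simp add: B_def a'_def mult.assoc)
    with n(1) show ?thesis by (rule that)
  qed
  \<comment> \<open>The negated pair supplies the values below a negative multiple of
    \<open>x powr (k / 2 - 1 / 4)\<close>.\<close>
  interpret neg: theta_transformation "\<lambda>n. - b n" "\<lambda>n. - B n" k "(2 * pi / c)\<^sup>2" "(2 * pi / c) powr k" p
    by (rule theta_transformation_uminus)
  have sum_eq: "(\<Sum>n | 1 \<le> n \<and> real n \<le> x. b n) = Re (twisted_sum a x \<alpha>)" for x
    unfolding twisted_sum_def Re_sum b_def by (intro sum.cong) (auto simp: a'_def e_def)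
  obtain \<epsilon>\<^sub>1 where \<epsilon>\<^sub>1: "\<epsilon>\<^sub>1 > 0"
    "\<exists>\<^sub>F x in at_top. Re (twisted_sum a x \<alpha>) > \<epsilon>\<^sub>1 * x powr (k / 2 - 1 / 4)"
    using partial_sum_frequently_large[OF m] unfolding sum_eq by blast
  obtain \<epsilon>\<^sub>2 where \<epsilon>\<^sub>2: "\<epsilon>\<^sub>2 > 0"
    "\<exists>\<^sub>F x in at_top. - Re (twisted_sum a x \<alpha>) > \<epsilon>\<^sub>2 * x powr (k / 2 - 1 / 4)"
    using neg.partial_sum_frequently_large[of m] m unfolding sum_negf sum_eq by auto
  have "\<forall>\<^sub>F x::real in at_top. x powr (k / 2 - 1 / 4) > 0"
    using eventually_gt_at_top[of 0] by eventually_elim simp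
  from Omega_pm_frequentlyI[OF \<epsilon>\<^sub>1 \<epsilon>\<^sub>2 this] show ?thesis
    by (simp add: \<alpha>_def)
qed

end
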